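(* Let $\alpha>0$, $\sigma_0>0$, $\beta>0$, $C_2>0$, $\gamma\in(0,\alpha)$, and let $F$ be a c.d.f. with $F(0)=0$ and $F(x)=\exp\{-\sigma^\alpha(x)x^{-\alpha}\}$ for $x>0$, where $\sigma:(0,\infty)\to(0,\infty]$ satisfies $\sigma(x)\to\sigma_0$ as $x\to\infty$ and $\sigma^\alpha(x)\ge C_2\min\{1,x^\gamma\}$ for all $x>0$. Suppose that $\sigma^\alpha(x)-\sigma_0^\alpha\sim C_1x^{-\beta}$ as $x\to\infty$ for some real $C_1\ne0$ (so that, in particular, $|\sigma^\alpha(x)-\sigma_0^\alpha|\le Cx^{-\beta}$ for some $C>0$ and all sufficiently large $x$). Let $X(1),X(2),\dots$ be i.i.d. with c.d.f. $F$, let $M_n:=n^{-1/\alpha}\max_{1\le i\le n}X(i)$, and let $Z$ have c.d.f. $\exp\{-\sigma_0^\alpha x^{-\alpha}\}$, $x>0$. Let $f:(0,\infty)\to\mathbb{R}$ be absolutely continuous on every compact interval $[a,b]\subset(0,\infty)$ with locally integrable derivative $f'$, and suppose that for some $m\in\mathbb{R}$ and $\delta>0$, $$x^m|f(x)|+\operatorname*{ess\,sup}_{0<y\le x}y^m|f'(y)|\to0\quad (x\downarrow0),\qquad x^{-\alpha}|f(x)|+x^{1+\delta}\operatorname*{ess\,sup}_{y\ge x}y^{-\alpha}|f'(y)|\to0\quad (x\to\infty),$$ and $\int_1^\infty x^{-(\alpha+\beta)}|f'(x)|\,dx<\infty$. Then $$n^{\beta/\alpha}\big(\mathbb{E}f(M_n)-\mathbb{E}f(Z)\big)\longrightarrow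 C_1\int_0^\infty x^{-(\alpha+\beta)}f'(x)e^{-\sigma_0^\alpha x^{-\alpha}}\,dx,\quad n\to\infty.$$
   Context: Convention: if $\sigma(x)=\infty$ then $F(x)=e^{-\infty}=0$. The essential supremum is taken with respect to Lebesgue measure. The symbol $\sim$ means that the ratio of the two sides tends to $1$. *)

theory Defs
  imports "HOL-Probability.Probability"
begin

text \<open>Powers and the exponential on the extended reals. The power is meant for positive base
  and positive exponent, so that \<open>\<infinity>\<close> to the power \<open>a\<close> is \<open>\<infinity>\<close>; the exponential
  satisfies the convention that \<open>e\<close> to the power \<open>-\<infinity>\<close> is \<open>0\<close>.\<close>

definition epowr :: "ereal \<Rightarrow> real \<Rightarrow> ereal" where
  "epowr s a = (if s = \<infinity> then \<infinity> else ereal (real_of_ereal s powr a))"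

definition eexp :: "ereal \<Rightarrow> ereal" where
  "eexp t = (if t = \<infinity> then \<infinity> else if t = - \<infinity> then 0 else ereal (exp (real_of_ereal t)))"

text \<open>Absolute continuity on \<open>[a,b]\<close>: the intervals \<open>(u k, v k)\<close>, \<open>k < n\<close>, form a finite
  family of pairwise disjoint subintervals.\<close>

definition abs_continuous_on_Icc :: "(real \<Rightarrow> real) \<Rightarrow> real \<Rightarrow> real \<Rightarrow> bool" where
  "abs_continuous_on_Icc f a b \<longleftrightarrow>
     (\<forall>\<epsilon>>0. \<exists>\<delta>>0. \<forall>(n::nat) u v.
        (\<forall>k<n. a \<le> u k \<and> u k \<le> v k \<and> v k \<le> b) \<longrightarrow>
        disjoint_family_on (\<lambda>k. {u k<..<v k}) {..<n} \<longrightarrow>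
        (\<Sum>k<n. v k - u k) < \<delta> \<longrightarrow>
        (\<Sum>k<n. \<bar>f (v k) - f (u k)\<bar>) < \<epsilon>)"

definition scaled_max :: "real \<Rightarrow> (nat \<Rightarrow> 'a \<Rightarrow> real) \<Rightarrow> nat \<Rightarrow> 'a \<Rightarrow> real" where
  "scaled_max \<alpha> X n \<omega> = real n powr (- (1 / \<alpha>)) * Max ((\<lambda>i. X i \<omega>) ` {1..n})"

text \<open>The expectation of \<open>f Y\<close>, for an almost surely positive random variable \<open>Y\<close> and a
  function \<open>f\<close> whose domain is the positive half-line. As HOL functions are total, the null event
  that \<open>Y\<close> is not positive is removed, so that the values of \<open>f\<close> outside its domain (and their
  possible non-measurability) play no role.\<close>

definition pos_integrable :: "'a measure \<Rightarrow> ('a \<Rightarrow> real) \<Rightarrow> (real \<Rightarrow> real) \<Rightarrow> bool" where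
  "pos_integrable M Y f \<longleftrightarrow> set_integrable M {\<omega> \<in> space M. 0 < Y \<omega>} (\<lambda>\<omega>. f (Y \<omega>))"

definition pos_expectation :: "'a measure \<Rightarrow> ('a \<Rightarrow> real) \<Rightarrow> (real \<Rightarrow> real) \<Rightarrow> real" where
  "pos_expectation M Y f = (LINT \<omega>:{\<omega> \<in> space M. 0 < Y \<omega>}|M. f (Y \<omega>))"

end

theory Submission
  imports Defs "HOL-Real_Asymp.Real_Asymp"
begin

text \<open>Let \<open>G\<close> and \<open>H n\<close> be the distribution functions of \<open>Z\<close> and of the scaled maximum. Since
  \<open>f\<close> is locally the integral of \<open>f'\<close>, Fubini expresses the difference of the expectations as
  the integral of \<open>f' (G - H n)\<close> over \<open>(0,\<infinity>)\<close>. The norming cancels the factor \<open>n\<close> in the exponent,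
  so \<open>H n x\<close> is \<open>exp (- s(y) * x powr -\<alpha>)\<close> with \<open>s\<close> the \<open>\<alpha>\<close>-th power of \<open>\<sigma>\<close> and
  \<open>y = n powr (1/\<alpha>) * x\<close>. Hence \<open>n powr (\<beta>/\<alpha>) * (G - H n)\<close> converges pointwise, and dominated
  convergence applies: where \<open>y\<close> is large, by the expansion of \<open>s\<close> at infinity; where \<open>y\<close> is bounded,
  because there \<open>n powr (\<beta>/\<alpha>)\<close> is at most a multiple of \<open>x powr -\<beta>\<close>, which is compensated by the
  decay of \<open>H n\<close> at \<open>0\<close>, at least like \<open>exp (- C2 * x powr (\<gamma> - \<alpha>))\<close> uniformly in \<open>n\<close>.\<close>

section \<open>The fundamental theorem of calculus for absolutely continuous functions\<close>

text \<open>Tagged divisions are finite sets of pairs, while the definition of absolute continuity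
  numbers its intervals; a bijection with \<open>{..<card I}\<close> carries the estimate
  over.\<close>

lemma abs_continuous_on_Icc_finite_family:
  assumes "abs_continuous_on_Icc f a b" and "e > 0"
  shows "\<exists>d>0. \<forall>(I :: 'i set) u v. finite I \<longrightarrow> (\<forall>i\<in>I. a \<le> u i \<and> u i \<le> v i \<and> v i \<le> b)
      \<longrightarrow> disjoint_family_on (\<lambda>i. {u i<..<v i}) I \<longrightarrow> (\<Sum>i\<in>I. v i - u i) < d
      \<longrightarrow> (\<Sum>i\<in>I. \<bar>f (v i) - f (u i)\<bar>) < e"
proof -
  obtain d where "d > 0" and d: "\<And>(n::nat) u v. (\<forall>k<n. a \<le> u k \<and> u k \<le> v k \<and> v k \<le> b) \<Longrightarrow>
        disjoint_family_on (\<lambda>k. {u k<..<v k}) {..<n} \<Longrightarrow>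
        (\<Sum>k<n. v k - u k) < d \<Longrightarrow> (\<Sum>k<n. \<bar>f (v k) - f (u k)\<bar>) < e"
    using assms unfolding abs_continuous_on_Icc_def by blast
  show ?thesis
  proof (intro exI[of _ d] conjI allI impI \<open>d > 0\<close>)
    fix I :: "'i set" and u v
    assume I: "finite I" "\<forall>i\<in>I. a \<le> u i \<and> u i \<le> v i \<and> v i \<le> b"
      "disjoint_family_on (\<lambda>i. {u i<..<v i}) I" "(\<Sum>i\<in>I. v i - u i) < d"
    obtain h where "bij_betw h {0..<card I} I"
      using ex_bij_betw_nat_finite[OF I(1)] by blast
    then have h: "bij_betw h {..<card I} I"
      by (simp add: atLeast0LessThan)
    have "(\<Sum>k<card I. \<bar>f (v (h k)) - f (u (h k))\<bar>) < e"
    proof (rule d)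
      show "\<forall>k<card I. a \<le> u (h k) \<and> u (h k) \<le> v (h k) \<and> v (h k) \<le> b"
        using I(2) bij_betwE[OF h] by blast
      show "disjoint_family_on (\<lambda>k. {u (h k)<..<v (h k)}) {..<card I}"
        using I(3) h unfolding disjoint_family_on_def bij_betw_def inj_on_def
        by (metis imageI)
      show "(\<Sum>k<card I. v (h k) - u (h k)) < d"
        using I(4) sum.reindex_bij_betw[OF h, of "\<lambda>i. v i - u i"] by simp
    qed
    then show "(\<Sum>i\<in>I. \<bar>f (v i) - f (u i)\<bar>) < e"
      using sum.reindex_bij_betw[OF h, of "\<lambda>i. \<bar>f (v i) - f (u i)\<bar>"] by simp
  qed
qed

text \<open>Directly from the definition of the gauge integral: tags outside the exceptional null set
  are controlled by the derivative, and the remaining intervals lie in an open set of small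
  measure, where absolute continuity applies.\<close>

theorem abs_continuous_fundamental_theorem_of_calculus:
  fixes f f' :: "real \<Rightarrow> real"
  assumes "a \<le> b" and ac: "abs_continuous_on_Icc f a b" and S: "negligible S"
    and deriv: "\<And>x. x \<in> {a..b} - S \<Longrightarrow> (f has_real_derivative f' x) (at x within {a..b})"
  shows "(f' has_integral (f b - f a)) {a..b}"
proof -
  \<comment> \<open>With the value 0 on \<open>S\<close>, tags in \<open>S\<close> contribute
    nothing to the Riemann sum; \<open>has_integral_spike\<close> restores \<open>f'\<close> at the
    end.\<close>
  define g where "g = (\<lambda>x. if x \<in> S then 0 else f' x)"
  have "(g has_integral (f b - f a)) {a..b}"
    unfolding has_integral_real
  proof (intro allI impI)
    fix e :: real assume "e > 0"
    obtain \<eta> where "\<eta> > 0"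
      and \<eta>: "\<And>(I :: (real \<times> real set) set) u v. finite I
        \<Longrightarrow> \<forall>i\<in>I. a \<le> u i \<and> u i \<le> v i \<and> v i \<le> b
        \<Longrightarrow> disjoint_family_on (\<lambda>i. {u i<..<v i}) I \<Longrightarrow> (\<Sum>i\<in>I. v i - u i) < \<eta>
        \<Longrightarrow> (\<Sum>i\<in>I. \<bar>f (v i) - f (u i)\<bar>) < e / 2"
      using abs_continuous_on_Icc_finite_family[OF ac half_gt_zero[OF \<open>e > 0\<close>]] by blast
    have S': "S \<in> null_sets lebesgue"
      using S by (simp add: negligible_iff_null_sets)
    \<comment> \<open>A null set has open neighbourhoods of arbitrarily small measure;
      \<open>\<eta>\<close> is the total length that absolute continuity tolerates for an error of
      e/2.\<close>
    obtain U where U: "open U" "S \<subseteq> U" "U - S \<in> lmeasurable"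
      "emeasure lebesgue (U - S) < ennreal \<eta>"
      using sets_lebesgue_outer_open[OF null_setsD2[OF S'] \<open>\<eta> > 0\<close>] by blast
    have "emeasure lebesgue U = emeasure lebesgue (U - S)"
      using emeasure_Diff_null_set[OF S', of U] U(1) by simp
    then have U_small: "emeasure lborel U < ennreal \<eta>"
      using U by simp
    \<comment> \<open>Summed over intervals of total length b - a, the relative error
      \<open>e'\<close> costs at most e/2; the summand 1 admits a = b.\<close>
    define e' where "e' = e / (2 * (b - a + 1))"
    have "e' > 0" using \<open>e > 0\<close> \<open>a \<le> b\<close> by (simp add: e'_def)
    \<comment> \<open>This is the radius of the gauge at \<open>x\<close>: differentiability
      provides it on \<open>{a..b} - S\<close>, openness of \<open>U\<close> on
      \<open>S\<close>.\<close>
    have "\<exists>d>0. (x \<in> {a..b} - S \<longrightarrow>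
        (\<forall>y\<in>{a..b}. \<bar>y - x\<bar> < d \<longrightarrow> \<bar>f y - f x - f' x * (y - x)\<bar> \<le> e' * \<bar>y - x\<bar>))
        \<and> (x \<in> S \<longrightarrow> ball x d \<subseteq> U)" for x
    proof (cases "x \<in> S")
      case True
      then obtain d where "d > 0" "ball x d \<subseteq> U"
        using U openE by blast
      with True show ?thesis by blast
    next
      case x: False
      show ?thesis
      proof (cases "x \<in> {a..b}")
        case True
        then have "(f has_derivative (*) (f' x)) (at x within {a..b})"
          using deriv x by (simp add: has_field_derivative_def)
        then obtain d where "d > 0"
          "\<forall>y\<in>{a..b}. norm (y - x) < d \<longrightarrow> norm (f y - f x - f' x * (y - x)) \<le> e' * norm (y - x)"
          using \<open>e' > 0\<close> unfolding has_derivative_within_alt by blast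
        with x show ?thesis by (intro exI[of _ d]) auto
      qed (auto intro: exI[of _ 1] simp: x)
    qed
    then obtain r where r: "\<And>x. r x > 0"
      and r_deriv: "\<And>x y. x \<in> {a..b} - S \<Longrightarrow> y \<in> {a..b} \<Longrightarrow> \<bar>y - x\<bar> < r x
        \<Longrightarrow> \<bar>f y - f x - f' x * (y - x)\<bar> \<le> e' * \<bar>y - x\<bar>"
      and r_U: "\<And>x. x \<in> S \<Longrightarrow> ball x (r x) \<subseteq> U"
      by metis
    show "\<exists>\<gamma>. gauge \<gamma> \<and> (\<forall>D. D tagged_division_of {a..b} \<and> \<gamma> fine D \<longrightarrow>
        norm ((\<Sum>(x, k)\<in>D. measure lborel k *\<^sub>R g x) - (f b - f a)) < e)"
    proof (intro exI[of _ "\<lambda>x. ball x (r x)"] conjI allI impI; (elim conjE)?)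
      show "gauge (\<lambda>x. ball x (r x))"
        using r by (auto simp: gauge_def)
      fix D assume D: "D tagged_division_of {a..b}" and fine: "(\<lambda>x. ball x (r x)) fine D"
      have fin: "finite D" using D by blast
      define u v where "u = (\<lambda>i :: real \<times> real set. Inf (snd i))"
        and "v = (\<lambda>i :: real \<times> real set. Sup (snd i))"
      have Dk: "a \<le> u (x, k) \<and> u (x, k) \<le> x \<and> x \<le> v (x, k) \<and> v (x, k) \<le> b
          \<and> k = {u (x, k)..v (x, k)} \<and> k \<subseteq> ball x (r x)" if xk: "(x, k) \<in> D" for x k
      proof -
        obtain c d where k: "k = {c..d}"
          using tagged_division_ofD(4)[OF D xk] by auto
        moreover have "x \<in> k" "k \<subseteq> {a..b}"
          using tagged_division_ofD(2,3)[OF D xk] by auto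
        moreover have "k \<subseteq> ball x (r x)" using fine xk by (auto dest: fineD)
        ultimately show ?thesis by (auto simp: u_def v_def)
      qed
      have "disjoint_family_on (\<lambda>i. interior (snd i)) D"
        using tagged_division_ofD(5)[OF D] by (force simp: disjoint_family_on_def)
      moreover have int: "interior (snd i) = {u i<..<v i}" if "i \<in> D" for i
        using Dk[of "fst i" "snd i"] that by (metis interior_atLeastAtMost_real prod.collapse)
      ultimately have disj: "disjoint_family_on (\<lambda>i. {u i<..<v i}) D"
        by (simp add: disjoint_family_on_def)
      \<comment> \<open>These are the intervals tagged in \<open>S\<close>. Their interiors are
        disjoint and lie in \<open>U\<close>, so their total length stays below
        \<open>\<eta>\<close>.\<close>
      define E where "E = {i \<in> D. fst i \<in> S}"
      have E: "finite E" "E \<subseteq> D" using fin by (auto simp: E_def)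
      have disjE: "disjoint_family_on (\<lambda>i. {u i<..<v i}) E"
        using disjoint_family_on_mono[OF E(2) disj] .
      have uvE: "a \<le> u i \<and> u i \<le> v i \<and> v i \<le> b" if "i \<in> D" for i
        using Dk[of "fst i" "snd i"] that by auto
      have "ennreal (\<Sum>i\<in>E. v i - u i) = (\<Sum>i\<in>E. emeasure lborel {u i<..<v i})"
        using uvE E by (subst sum_ennreal[symmetric]) (auto intro!: sum.cong simp: subset_iff)
      also have "\<dots> = emeasure lborel (\<Union>i\<in>E. {u i<..<v i})"
        using disjE E by (intro sum_emeasure) auto
      also have "\<dots> \<le> emeasure lborel U"
      proof (rule emeasure_mono)
        have "{u i<..<v i} \<subseteq> U" if "i \<in> E" for i
        proof -
          have "snd i \<subseteq> U" using Dk[of "fst i" "snd i"] r_U[of "fst i"] that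
            by (auto simp: E_def)
          moreover have "{u i<..<v i} \<subseteq> snd i"
            using int[of i] that E by (metis interior_subset subsetD)
          ultimately show ?thesis by blast
        qed
        then show "(\<Union>i\<in>E. {u i<..<v i}) \<subseteq> U" by blast
      qed (use U in auto)
      finally have "ennreal (\<Sum>i\<in>E. v i - u i) < ennreal \<eta>"
        using U_small by (rule le_less_trans)
      then have "(\<Sum>i\<in>E. v i - u i) < \<eta>"
        using \<open>\<eta> > 0\<close> by (simp add: ennreal_less_iff sum_nonneg uvE subsetD[OF E(2)])
      then have sumE: "(\<Sum>i\<in>E. \<bar>f (v i) - f (u i)\<bar>) < e / 2"
        using E uvE disjE by (intro \<eta>) blast+
      have len: "measure lborel (snd i) = v i - u i" if "i \<in> D" for i
        using Dk[of "fst i" "snd i"] uvE[OF that] that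
        by (metis content_real prod.collapse)
      \<comment> \<open>As in the straddle lemma, the tag lies between the endpoints, so the
        linearization errors at the two ends add up to at most \<open>e'\<close> times the
        length.\<close>
      have bound: "\<bar>measure lborel (snd i) * g (fst i) - (f (v i) - f (u i))\<bar> \<le> e' * measure lborel (snd i)"
        if i: "i \<in> D - E" for i
      proof -
        obtain x k where ixk: "i = (x, k)" by (cases i)
        have x: "x \<in> {a..b} - S" and uv: "a \<le> u i" "u i \<le> x" "x \<le> v i" "v i \<le> b"
          and k: "k = {u i..v i}" "k \<subseteq> ball x (r x)"
          using Dk[of x k] i by (auto simp: E_def ixk)
        have "u i \<in> k" "v i \<in> k"
          using k(1) uv by auto
        then have "u i \<in> ball x (r x)" "v i \<in> ball x (r x)"
          using k(2) by blast+
        then have close: "\<bar>u i - x\<bar> < r x" "\<bar>v i - x\<bar> < r x"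
          by (auto simp: dist_real_def)
        have "\<bar>f (v i) - f x - f' x * (v i - x)\<bar> \<le> e' * \<bar>v i - x\<bar>"
          "\<bar>f (u i) - f x - f' x * (u i - x)\<bar> \<le> e' * \<bar>u i - x\<bar>"
          using r_deriv[OF x _ close(2)] r_deriv[OF x _ close(1)] uv by auto
        moreover have "measure lborel (snd i) * g (fst i) - (f (v i) - f (u i))
          = (f (u i) - f x - f' x * (u i - x)) - (f (v i) - f x - f' x * (v i - x))"
        proof -
          have "measure lborel (snd i) = v i - u i" "g (fst i) = f' x"
            using len[of i] i x by (auto simp: ixk g_def)
          then show ?thesis by (simp only:) (simp add: algebra_simps)
        qed
        moreover have "e' * measure lborel (snd i) = e' * \<bar>v i - x\<bar> + e' * \<bar>u i - x\<bar>"
        proof -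
          have "measure lborel (snd i) = v i - u i" using len i by blast
          then show ?thesis using uv by (simp only:) (simp add: algebra_simps)
        qed
        ultimately show ?thesis by linarith
      qed
      have "(\<Sum>(x, k)\<in>D. measure lborel k *\<^sub>R g x) - (f b - f a)
          = (\<Sum>i\<in>D. measure lborel (snd i) * g (fst i) - (f (v i) - f (u i)))"
        using additive_tagged_division_1[OF \<open>a \<le> b\<close> D, of f]
        by (simp add: sum_subtractf case_prod_unfold u_def v_def)
      also have "\<bar>\<dots>\<bar> \<le> (\<Sum>i\<in>D. \<bar>measure lborel (snd i) * g (fst i) - (f (v i) - f (u i))\<bar>)"
        by (rule sum_abs)
      also have "\<dots> = (\<Sum>i\<in>D - E. \<bar>measure lborel (snd i) * g (fst i) - (f (v i) - f (u i))\<bar>)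
          + (\<Sum>i\<in>E. \<bar>measure lborel (snd i) * g (fst i) - (f (v i) - f (u i))\<bar>)"
        using sum.subset_diff[OF E(2) fin] by simp
      also have "\<dots> \<le> (\<Sum>i\<in>D - E. e' * measure lborel (snd i)) + (\<Sum>i\<in>E. \<bar>f (v i) - f (u i)\<bar>)"
      proof (intro add_mono sum_mono bound)
        fix i assume "i \<in> E"
        then show "\<bar>measure lborel (snd i) * g (fst i) - (f (v i) - f (u i))\<bar> \<le> \<bar>f (v i) - f (u i)\<bar>"
          by (simp add: E_def g_def)
      qed
      also have "\<dots> < e' * (\<Sum>i\<in>D. measure lborel (snd i)) + e / 2"
      proof -
        have "(\<Sum>i\<in>D - E. e' * measure lborel (snd i)) \<le> (\<Sum>i\<in>D. e' * measure lborel (snd i))"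
          using fin \<open>e' > 0\<close> by (intro sum_mono2) auto
        then show ?thesis using sumE by (simp add: sum_distrib_left)
      qed
      also have "(\<Sum>i\<in>D. measure lborel (snd i)) = b - a"
        using additive_content_tagged_division[of D a b] D \<open>a \<le> b\<close>
        by (simp add: case_prod_unfold)
      also have "e' * (b - a) + e / 2 \<le> e"
        using \<open>a \<le> b\<close> \<open>e > 0\<close> by (simp add: e'_def field_simps)
      finally show "norm ((\<Sum>(x, k)\<in>D. measure lborel k *\<^sub>R g x) - (f b - f a)) < e"
        by simp
    qed
  qed
  then show ?thesis
    by (rule has_integral_spike[OF S, rotated]) (simp add: g_def)
qed

section \<open>Passage between Lebesgue and Borel integrands\<close>

lemma set_integral_lebesgue_lborel:
  fixes u v :: "real \<Rightarrow> real"
  assumes [measurable]: "S \<in> sets borel" "v \<in> borel_measurable borel"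
    and u: "(\<lambda>x. indicator S x * u x) \<in> borel_measurable lebesgue"
    and eq: "AE x in lborel. x \<in> S \<longrightarrow> u x = v x"
  shows "set_integrable lebesgue S u \<longleftrightarrow> set_integrable lborel S v"
    and "(LINT x:S|lebesgue. u x) = (LINT x:S|lborel. v x)"
proof -
  have v: "(\<lambda>x. indicator S x * v x) \<in> borel_measurable lborel" by measurable
  have v': "(\<lambda>x. indicator S x * v x) \<in> borel_measurable lebesgue"
    by (rule measurable_completion[OF v])
  have ae: "AE x in lebesgue. indicator S x * u x = indicator S x * v x"
    using AE_completion[OF eq] by eventually_elim (auto simp: indicator_def)
  show "set_integrable lebesgue S u \<longleftrightarrow> set_integrable lborel S v"
    using integrable_cong_AE[OF u v' ae] integrable_completion[OF v]
    by (simp add: set_integrable_def)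
  show "(LINT x:S|lebesgue. u x) = (LINT x:S|lborel. v x)"
    using integral_cong_AE[OF u v' ae] integral_completion[OF v]
    by (simp add: set_lebesgue_integral_def)
qed

text \<open>The intervals [1/(k+1), k+1] exhaust the half-line, and at each point the truncated
  function is eventually constant in \<open>k\<close>.\<close>

lemma borel_measurable_lebesgue_Ioi:
  fixes u :: "real \<Rightarrow> real"
  assumes "\<And>a b. 0 < a \<Longrightarrow> a \<le> b \<Longrightarrow> set_integrable lebesgue {a..b} u"
  shows "(\<lambda>x. indicator {0<..} x * u x) \<in> borel_measurable lebesgue"
proof (rule borel_measurable_LIMSEQ_real)
  show "(\<lambda>x. indicator {1 / (real k + 1)..real k + 1} x * u x) \<in> borel_measurable lebesgue" for k
  proof -
    have "1 / (real k + 1) \<le> 1" "1 \<le> real k + 1" by simp_all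
    then have "1 / (real k + 1) \<le> real k + 1" by linarith
    then have "set_integrable lebesgue {1 / (real k + 1)..real k + 1} u"
      by (intro assms) simp_all
    then show ?thesis
      unfolding set_integrable_def by (auto dest: borel_measurable_integrable)
  qed
  show "(\<lambda>k. indicator {1 / (real k + 1)..real k + 1} x * u x) \<longlonglongrightarrow> indicator {0<..} x * u x" for x
  proof (cases "x > 0")
    case True
    have "(\<lambda>k. 1 / (real k + 1)) \<longlonglongrightarrow> 0" "filterlim (\<lambda>k. real k + 1) at_top sequentially"
      by real_asymp+
    then have "\<forall>\<^sub>F k in sequentially. 1 / (real k + 1) < x" "\<forall>\<^sub>F k in sequentially. x \<le> real k + 1"
      using True by (auto dest: order_tendstoD(2) simp: filterlim_at_top)
    then have "\<forall>\<^sub>F k in sequentially.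
        indicator {1 / (real k + 1)..real k + 1} x * u x = indicator {0<..} x * u x"
      by eventually_elim (use True in \<open>simp add: indicator_def\<close>)
    then show ?thesis by (rule tendsto_eventually)
  next
    case False
    then have "x < 1 / (real k + 1)" for k
      by (rule order_le_less_trans[OF leI]) simp
    then have "indicator {1 / (real k + 1)..real k + 1} x = (0::real)" for k
      by (simp add: indicator_def not_le)
    then show ?thesis using False by simp
  qed
qed

text \<open>Fubini with the probability space works over \<open>lborel\<close>, whereas the
  hypotheses on \<open>f'\<close> concern the completed measure; hence a Borel version of
  \<open>f'\<close>. Absolute continuity makes the increments of \<open>f\<close> integrals of this
  version.\<close>

lemma borel_density_of_abs_continuous:
  fixes f f' :: "real \<Rightarrow> real"
  assumes f_ac: "\<And>a b. 0 < a \<Longrightarrow> a \<le> b \<Longrightarrow> abs_continuous_on_Icc f a b"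
    and f'_int: "\<And>a b. 0 < a \<Longrightarrow> a \<le> b \<Longrightarrow> set_integrable lebesgue {a..b} f'"
    and f_deriv: "AE x in lebesgue. 0 < x \<longrightarrow> (f has_real_derivative f' x) (at x)"
  obtains g where "g \<in> borel_measurable borel" and "AE x in lborel. 0 < x \<longrightarrow> f' x = g x"
    and "\<And>a b. 0 < a \<Longrightarrow> a \<le> b \<Longrightarrow> set_integrable lborel {a..b} g"
    and "\<And>a b. 0 < a \<Longrightarrow> a \<le> b \<Longrightarrow> (LINT x:{a..b}|lborel. g x) = f b - f a"
proof -
  obtain g where g: "g \<in> borel_measurable lborel"
    and ae: "AE x in lborel. indicator {0<..} x * f' x = g x"
    using completion_ex_borel_measurable_real[OF borel_measurable_lebesgue_Ioi[OF f'_int]] by auto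
  have g_borel: "g \<in> borel_measurable borel" using g by simp
  have g_eq: "AE x in lborel. 0 < x \<longrightarrow> f' x = g x"
    using ae by eventually_elim (auto simp: indicator_def)
  have conv: "set_integrable lborel {a..b} g \<and> (LINT x:{a..b}|lborel. g x) = f b - f a"
    if ab: "0 < a" "a \<le> b" for a b
  proof -
    have int: "set_integrable lebesgue {a..b} f'" by (rule f'_int[OF ab])
    then have meas: "(\<lambda>x. indicator {a..b} x * f' x) \<in> borel_measurable lebesgue"
      unfolding set_integrable_def by (auto dest: borel_measurable_integrable)
    have ae_ab: "AE x in lborel. x \<in> {a..b} \<longrightarrow> f' x = g x"
      using g_eq by eventually_elim (use ab in auto)
    note transfer = set_integral_lebesgue_lborel[OF _ g_borel meas ae_ab]
    define D where "D = {x. \<not> (0 < x \<longrightarrow> (f has_real_derivative f' x) (at x))}"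
    have "D \<in> null_sets lebesgue"
      using f_deriv by (simp add: D_def completion.AE_iff_null_sets)
    then have D: "negligible D" by (simp add: negligible_iff_null_sets)
    have "(f' has_integral f b - f a) {a..b}"
    proof (rule abs_continuous_fundamental_theorem_of_calculus[OF \<open>a \<le> b\<close> f_ac[OF ab] D])
      fix x assume "x \<in> {a..b} - D"
      then have "(f has_real_derivative f' x) (at x)"
        using ab by (auto simp: D_def)
      then show "(f has_real_derivative f' x) (at x within {a..b})"
        by (rule has_field_derivative_at_within)
    qed
    then have "(LINT x:{a..b}|lebesgue. f' x) = f b - f a"
      using has_integral_set_lebesgue[OF int] has_integral_unique by blast
    then show ?thesis using transfer int by simp
  qed
  show thesis
    by (rule that[OF g_borel g_eq]) (use conv in blast)+
qed

section \<open>Expectations as integrals against the distribution function\<close>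

text \<open>The Fubini kernel below lives on half-open intervals; closing them adds only a null
  point.\<close>

lemma integral_atLeastLessThan_lborel:
  fixes g :: "real \<Rightarrow> real"
  assumes [measurable]: "g \<in> borel_measurable borel"
    and "set_integrable lborel {a..b} g"
  shows "integrable lborel (\<lambda>x. indicator {a..<b} x * g x)"
    and "(LINT x|lborel. indicator {a..<b} x * g x) = (LINT x:{a..b}|lborel. g x)"
proof -
  have ae: "AE x in lborel. indicator {a..<b} x * g x = indicator {a..b} x * g x"
    using AE_lborel_singleton[of b] by eventually_elim (auto simp: indicator_def)
  show "integrable lborel (\<lambda>x. indicator {a..<b} x * g x)"
    using assms(2) integrable_cong_AE[OF _ _ ae] by (simp add: set_integrable_def)
  show "(LINT x|lborel. indicator {a..<b} x * g x) = (LINT x:{a..b}|lborel. g x)"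
    using integral_cong_AE[OF _ _ ae] by (simp add: set_lebesgue_integral_def)
qed

text \<open>Fubini applied to \<open>f y - f 1 = \<integral> g(x) (1{x \<ge> 1} - 1{x \<ge> y}) dx\<close>. The base point \<open>1\<close>
  serves both tails, and as the sign of the kernel depends on \<open>x\<close> alone, the assumption is also
  the absolute integrability on the product space.\<close>

lemma pos_expectation_by_parts:
  fixes f g :: "real \<Rightarrow> real" and M :: "'a measure"
  assumes "prob_space M" and Y[measurable]: "Y \<in> borel_measurable M"
    and pos: "AE \<omega> in M. 0 < Y \<omega>"
    and g[measurable]: "g \<in> borel_measurable borel"
    and g_int: "\<And>a b. 0 < a \<Longrightarrow> a \<le> b \<Longrightarrow> set_integrable lborel {a..b} g"
    and f_eq: "\<And>a b. 0 < a \<Longrightarrow> a \<le> b \<Longrightarrow> (LINT x:{a..b}|lborel. g x) = f b - f a"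
    and int: "set_integrable lborel {0<..}
      (\<lambda>x. g x * (indicator {1..} x - cdf (distr M borel Y) x))"
  shows "pos_integrable M Y f"
    and "pos_expectation M Y f
      = f 1 + (LINT x:{0<..}|lborel. g x * (indicator {1..} x - cdf (distr M borel Y) x))"
proof -
  interpret M: prob_space M by fact
  interpret P: pair_sigma_finite lborel M ..
  \<comment> \<open>On positive \<open>x\<close> and for positive \<open>Y\<close>, this is 1 on
    [1,Y), -1 on [Y,1) and 0 elsewhere. Integrated against \<open>g\<close> it gives f(Y) -
    f(1).\<close>
  define k where "k x \<omega> = (indicator {1..} x - (if Y \<omega> \<le> x then 1 else 0) :: real)" for x \<omega>
  define h where "h x \<omega> = indicator {0<..} x * g x * k x \<omega>" for x \<omega>
  have [measurable]: "case_prod k \<in> borel_measurable (lborel \<Otimes>\<^sub>M M)"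
    unfolding k_def by measurable
  have [measurable]: "case_prod h \<in> borel_measurable (lborel \<Otimes>\<^sub>M M)"
    unfolding h_def by measurable
  have k_meas: "k x \<in> borel_measurable M" for x
    unfolding k_def by measurable
  have k_int: "integrable M (k x)" for x
    by (rule M.integrable_const_bound[of _ 1]) (auto simp: k_def indicator_def k_meas)
  have cdf: "cdf (distr M borel Y) x = (LINT \<omega>|M. (if Y \<omega> \<le> x then 1 else 0))" for x
  proof -
    have "(LINT \<omega>|M. (if Y \<omega> \<le> x then 1 else 0)) = (LINT \<omega>|M. indicator (Y -` {..x} \<inter> space M) \<omega>)"
      by (intro Bochner_Integration.integral_cong) (auto simp: indicator_def)
    also have "\<dots> = measure M (Y -` {..x} \<inter> space M)" by simp
    finally show ?thesis by (simp add: cdf_def measure_distr)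
  qed
  have k_mean: "(LINT \<omega>|M. k x \<omega>) = indicator {1..} x - cdf (distr M borel Y) x" for x
  proof -
    have "integrable M (\<lambda>\<omega>. if Y \<omega> \<le> x then 1 else 0 :: real)"
      by (rule M.integrable_const_bound[of _ 1]) auto
    then show ?thesis
      by (simp add: k_def cdf M.prob_space)
  qed
  have "(LINT \<omega>|M. norm (k x \<omega>)) = norm (LINT \<omega>|M. k x \<omega>)" for x
  proof (cases "x \<ge> 1")
    case True
    then have nn: "0 \<le> k x \<omega>" for \<omega> by (simp add: k_def)
    then have "0 \<le> (LINT \<omega>|M. k x \<omega>)" by (intro Bochner_Integration.integral_nonneg)
    with nn show ?thesis by simp
  next
    case False
    then have nn: "k x \<omega> \<le> 0" for \<omega> by (simp add: k_def)
    then have "0 \<le> (LINT \<omega>|M. - k x \<omega>)" by (intro Bochner_Integration.integral_nonneg) simp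
    with nn show ?thesis by simp
  qed
  then have "(LINT \<omega>|M. norm (h x \<omega>))
      = norm (indicator {0<..} x * (g x * (indicator {1..} x - cdf (distr M borel Y) x)))" for x
    by (simp add: h_def abs_mult k_mean)
  moreover have int': "integrable lborel
      (\<lambda>x. indicator {0<..} x * (g x * (indicator {1..} x - cdf (distr M borel Y) x)))"
    using int by (simp add: set_integrable_def)
  ultimately have "integrable lborel (\<lambda>x. LINT \<omega>|M. norm (h x \<omega>))"
    using integrable_norm[OF int'] by simp
  then have h_int: "integrable (lborel \<Otimes>\<^sub>M M) (case_prod h)"
    by (intro P.Fubini_integrable) (auto simp: h_def intro!: k_int)
  have h_f: "(LINT x|lborel. h x \<omega>) = f (Y \<omega>) - f 1" if "0 < Y \<omega>" for \<omega>
  proof (cases "1 \<le> Y \<omega>")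
    case True
    then have "h x \<omega> = indicator {1..<Y \<omega>} x * g x" for x
      by (auto simp: h_def k_def indicator_def)
    then show ?thesis
      using integral_atLeastLessThan_lborel(2)[OF g g_int] f_eq True by simp
  next
    case False
    then have "h x \<omega> = - (indicator {Y \<omega>..<1} x * g x)" for x
      using that by (auto simp: h_def k_def indicator_def)
    then show ?thesis
      using integral_atLeastLessThan_lborel(2)[OF g g_int] f_eq that False by simp
  qed
  have h_int': "integrable M (\<lambda>\<omega>. LINT x|lborel. h x \<omega>)"
    by (rule P.integrable_snd[OF h_int])
  \<comment> \<open>Off the event that \<open>Y\<close> is positive both sides vanish. On it, the
    right-hand side supplies the measurability of f(Y).\<close>
  have pointwise: "indicator {\<omega> \<in> space M. 0 < Y \<omega>} \<omega> *\<^sub>R f (Y \<omega>)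
      = indicator {\<omega> \<in> space M. 0 < Y \<omega>} \<omega> *\<^sub>R (f 1 + (LINT x|lborel. h x \<omega>))" for \<omega>
    using h_f by (auto simp: indicator_def)
  show "pos_integrable M Y f"
    unfolding pos_integrable_def set_integrable_def pointwise
    by (intro integrable_mult_indicator Bochner_Integration.integrable_add h_int') auto
  have "pos_expectation M Y f = (LINT \<omega>|M. f 1 + (LINT x|lborel. h x \<omega>))"
    unfolding pos_expectation_def set_lebesgue_integral_def pointwise
    using pos h_int' by (intro integral_cong_AE) (auto elim!: eventually_mono simp: indicator_def)
  also have "\<dots> = f 1 + (LINT \<omega>|M. LINT x|lborel. h x \<omega>)"
    using h_int' by (simp add: M.prob_space)
  also have "(LINT \<omega>|M. LINT x|lborel. h x \<omega>) = (LINT x|lborel. LINT \<omega>|M. h x \<omega>)"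
    by (rule P.Fubini_integral[OF h_int])
  also have "\<dots> = (LINT x:{0<..}|lborel. g x * (indicator {1..} x - cdf (distr M borel Y) x))"
    by (simp add: h_def k_mean set_lebesgue_integral_def mult.assoc)
  finally show "pos_expectation M Y f
      = f 1 + (LINT x:{0<..}|lborel. g x * (indicator {1..} x - cdf (distr M borel Y) x))" .
qed

section \<open>The distribution function of the scaled maximum\<close>

lemma scaled_max_le_iff:
  assumes "n \<ge> 1"
  shows "scaled_max \<alpha> X n \<omega> \<le> x \<longleftrightarrow> (\<forall>i\<in>{1..n}. X i \<omega> \<le> real n powr (1 / \<alpha>) * x)"
proof -
  have "scaled_max \<alpha> X n \<omega> \<le> x \<longleftrightarrow> Max ((\<lambda>i. X i \<omega>) ` {1..n}) \<le> real n powr (1 / \<alpha>) * x"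
    using assms by (simp add: scaled_max_def powr_minus field_simps)
  also have "\<dots> \<longleftrightarrow> (\<forall>i\<in>{1..n}. X i \<omega> \<le> real n powr (1 / \<alpha>) * x)"
    using assms by (subst Max_le_iff) auto
  finally show ?thesis .
qed

lemma cdf_distr:
  assumes "Y \<in> borel_measurable M"
  shows "cdf (distr M borel Y) x = measure M {\<omega> \<in> space M. Y \<omega> \<le> x}"
proof -
  have "Y -` {..x} \<inter> space M = {\<omega> \<in> space M. Y \<omega> \<le> x}" by auto
  then show ?thesis using assms by (simp add: cdf_def measure_distr)
qed

lemma borel_measurable_scaled_max:
  assumes "\<And>i. i \<ge> 1 \<Longrightarrow> X i \<in> borel_measurable M"
  shows "scaled_max \<alpha> X n \<in> borel_measurable M"
proof -
  have "(\<lambda>\<omega>. Max ((\<lambda>i. X i \<omega>) ` {1..n})) \<in> borel_measurable M"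
    using assms by (intro borel_measurable_Max) auto
  then show ?thesis unfolding scaled_max_def[abs_def] by measurable
qed

lemma cdf_scaled_max:
  assumes "prob_space M" and indep: "prob_space.indep_vars M (\<lambda>_. borel) X {1..}"
    and F: "\<And>i. i \<ge> 1 \<Longrightarrow> cdf (distr M borel (X i)) = F" and "n \<ge> 1"
  shows "cdf (distr M borel (scaled_max \<alpha> X n)) x = F (real n powr (1 / \<alpha>) * x) ^ n"
proof -
  interpret prob_space M by fact
  have X: "X i \<in> borel_measurable M" if "i \<ge> 1" for i
    using indep that by (simp add: indep_vars_def2)
  let ?y = "real n powr (1 / \<alpha>) * x"
  have "cdf (distr M borel (scaled_max \<alpha> X n)) x
      = measure M {\<omega> \<in> space M. scaled_max \<alpha> X n \<omega> \<le> x}"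
    by (intro cdf_distr borel_measurable_scaled_max X)
  also have "{\<omega> \<in> space M. scaled_max \<alpha> X n \<omega> \<le> x} = (\<Inter>i\<in>{1..n}. X i -` {..?y} \<inter> space M)"
    using \<open>n \<ge> 1\<close> by (auto simp: scaled_max_le_iff)
  \<comment> \<open>Independence factorizes the event that all \<open>X i\<close> stay below the
    threshold; \<open>n \<ge> 1\<close> keeps the index set nonempty.\<close>
  also have "measure M \<dots> = (\<Prod>i\<in>{1..n}. measure M (X i -` {..?y} \<inter> space M))"
    using \<open>n \<ge> 1\<close> by (intro indep_varsD[OF indep]) auto
  also have "\<dots> = (\<Prod>i\<in>{1..n}. F ?y)"
  proof (rule prod.cong)
    fix i assume "i \<in> {1..n}"
    then have "i \<ge> 1" by simp
    then show "measure M (X i -` {..?y} \<inter> space M) = F ?y"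
      using F[of i] X[of i] by (simp add: cdf_def measure_distr fun_eq_iff flip: F)
  qed simp
  finally show ?thesis by simp
qed

lemma AE_pos_cdf:
  assumes "prob_space M" and Y: "Y \<in> borel_measurable M" and "cdf (distr M borel Y) 0 = 0"
  shows "AE \<omega> in M. 0 < Y \<omega>"
proof -
  interpret prob_space M by fact
  have [measurable]: "Y \<in> borel_measurable M" by fact
  have "measure M {\<omega> \<in> space M. \<not> 0 < Y \<omega>} = 0"
    using assms by (simp add: cdf_distr not_less)
  then show ?thesis
    by (intro AE_I[OF order_refl]) (auto simp: emeasure_eq_measure)
qed

section \<open>Rate of convergence of the distribution functions\<close>

text \<open>Mean value estimate: for t >= c the slope of exp(-t) is at most exp(-c) in absolute
  value. Once the two points are ordered, 1 + t <= exp t suffices.\<close>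

lemma abs_exp_minus_diff_le:
  fixes a b c :: real
  assumes "c \<le> a" and "c \<le> b"
  shows "\<bar>exp (-a) - exp (-b)\<bar> \<le> \<bar>a - b\<bar> * exp (-c)"
  using assms
proof (induction a b rule: linorder_wlog)
  case (le a b)
  have "exp (-a) - exp (-b) = exp (-a) * (1 - exp (a - b))"
    by (simp add: algebra_simps exp_diff exp_minus field_simps)
  also have "\<dots> \<le> exp (-a) * (b - a)"
    using exp_ge_add_one_self[of "a - b"] by (intro mult_left_mono) (linarith, simp)
  also have "\<dots> \<le> exp (-c) * (b - a)"
    using le by (intro mult_right_mono) auto
  finally show ?case using le by (simp add: abs_if mult.commute)
next
  case (sym a b)
  then show ?case by (simp add: abs_minus_commute)
qed

text \<open>Since n * y^(-\<alpha>) = x^(-\<alpha>) for y = n^(1/\<alpha>) * x, the power of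
  \<open>F\<close> is exp(-s0 x^(-\<alpha>)) * exp(-u) with u = (s(y) - s0) x^(-\<alpha>). By the
  expansion of \<open>s\<close>, n^(\<beta>/\<alpha>) u tends to C1 x^(-(\<alpha>+\<beta>)). Hence u
  tends to 0, and 1 - exp(-u) is asymptotic to u.\<close>

lemma cdf_power_asymptotics:
  fixes \<alpha> s0 \<beta> C1 x :: real and F s :: "real \<Rightarrow> real"
  assumes "\<alpha> > 0" "\<beta> > 0" "C1 \<noteq> 0" "x > 0"
    and F_eq: "\<forall>\<^sub>F y in at_top. F y = exp (- (s y * y powr (- \<alpha>)))"
    and s_asymp: "((\<lambda>y. (s y - s0) / (C1 * y powr (- \<beta>))) \<longlongrightarrow> 1) at_top"
  shows "(\<lambda>n. real n powr (\<beta> / \<alpha>)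
      * (exp (- (s0 * x powr (- \<alpha>))) - F (real n powr (1 / \<alpha>) * x) ^ n))
    \<longlonglongrightarrow> C1 * (x powr (- (\<alpha> + \<beta>)) * exp (- (s0 * x powr (- \<alpha>))))"
proof -
  define y where "y n = real n powr (1 / \<alpha>) * x" for n
  define r where "r n = (s (y n) - s0) / (C1 * y n powr (- \<beta>))" for n
  define u where "u n = (s (y n) - s0) * x powr (- \<alpha>)" for n
  have y_lim: "filterlim y at_top sequentially"
    unfolding y_def using \<open>\<alpha> > 0\<close> \<open>x > 0\<close> by real_asymp
  have r_lim: "r \<longlonglongrightarrow> 1"
    unfolding r_def using filterlim_compose[OF s_asymp y_lim] .
  have u_eq: "real n powr (\<beta> / \<alpha>) * u n = r n * (C1 * x powr (- (\<alpha> + \<beta>)))" if "n > 0" for n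
  proof -
    have "y n > 0" using that \<open>x > 0\<close> by (simp add: y_def)
    then have "s (y n) - s0 = r n * (C1 * y n powr (- \<beta>))"
      using \<open>C1 \<noteq> 0\<close> by (simp add: r_def)
    moreover have "real n powr (\<beta> / \<alpha>) * y n powr (- \<beta>) = x powr (- \<beta>)"
      using that \<open>x > 0\<close> \<open>\<alpha> > 0\<close>
      by (simp add: y_def powr_mult powr_powr powr_add[symmetric] mult.assoc[symmetric])
    moreover have "x powr (- (\<alpha> + \<beta>)) = x powr (- \<beta>) * x powr (- \<alpha>)"
      by (simp add: powr_add[symmetric] algebra_simps)
    ultimately show ?thesis unfolding u_def by algebra
  qed
  have ev_pos: "\<forall>\<^sub>F n in sequentially. n > (0::nat)"
    by (rule eventually_gt_at_top)
  have nu_lim: "(\<lambda>n. real n powr (\<beta> / \<alpha>) * u n) \<longlonglongrightarrow> C1 * x powr (- (\<alpha> + \<beta>))"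
  proof (rule Lim_transform_eventually)
    show "(\<lambda>n. r n * (C1 * x powr (- (\<alpha> + \<beta>)))) \<longlonglongrightarrow> C1 * x powr (- (\<alpha> + \<beta>))"
      using tendsto_mult_right[OF r_lim, of "C1 * x powr (- (\<alpha> + \<beta>))"] by simp
    show "\<forall>\<^sub>F n in sequentially. r n * (C1 * x powr (- (\<alpha> + \<beta>))) = real n powr (\<beta> / \<alpha>) * u n"
      using ev_pos by eventually_elim (simp add: u_eq)
  qed
  have "(\<lambda>n. real n powr (- (\<beta> / \<alpha>))) \<longlonglongrightarrow> 0"
    using \<open>\<alpha> > 0\<close> \<open>\<beta> > 0\<close> by real_asymp
  from tendsto_mult[OF this nu_lim]
  have "(\<lambda>n. real n powr (- (\<beta> / \<alpha>)) * (real n powr (\<beta> / \<alpha>) * u n)) \<longlonglongrightarrow> 0"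
    by simp
  moreover have "\<forall>\<^sub>F n in sequentially.
      real n powr (- (\<beta> / \<alpha>)) * (real n powr (\<beta> / \<alpha>) * u n) = u n"
    using ev_pos by eventually_elim (simp add: powr_add[symmetric] mult.assoc[symmetric])
  ultimately have u_lim: "u \<longlonglongrightarrow> 0"
    by (rule Lim_transform_eventually)
  \<comment> \<open>The limit of (1 - exp(-u))/u at 0 is a punctured one, so \<open>u n\<close> must
    avoid 0.\<close>
  have u_nz: "\<forall>\<^sub>F n in sequentially. u n \<noteq> 0"
    using tendsto_imp_eventually_ne[OF r_lim one_neq_zero] ev_pos
  proof eventually_elim
    case (elim n)
    then have "real n powr (\<beta> / \<alpha>) * u n \<noteq> 0"
      using u_eq[of n] \<open>C1 \<noteq> 0\<close> \<open>x > 0\<close> by simp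
    then show "u n \<noteq> 0" by simp
  qed
  have "((\<lambda>u::real. 1 - exp (- u)) has_real_derivative 1) (at 0)"
    by (auto intro!: derivative_eq_intros)
  then have "((\<lambda>u::real. (1 - exp (- u)) / u) \<longlongrightarrow> 1) (at 0)"
    by (simp add: has_field_derivative_iff)
  moreover have "filterlim u (at 0) sequentially"
    using u_lim u_nz by (simp add: filterlim_at)
  ultimately have quot: "(\<lambda>n. (1 - exp (- u n)) / u n) \<longlonglongrightarrow> 1"
    by (rule filterlim_compose)
  have "(\<lambda>n. exp (- (s0 * x powr (- \<alpha>))) * (real n powr (\<beta> / \<alpha>) * u n * ((1 - exp (- u n)) / u n)))
      \<longlonglongrightarrow> exp (- (s0 * x powr (- \<alpha>))) * (C1 * x powr (- (\<alpha> + \<beta>)) * 1)"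
    by (intro tendsto_mult_left tendsto_mult nu_lim quot)
  moreover have "\<forall>\<^sub>F n in sequentially.
      exp (- (s0 * x powr (- \<alpha>))) * (real n powr (\<beta> / \<alpha>) * u n * ((1 - exp (- u n)) / u n))
      = real n powr (\<beta> / \<alpha>) * (exp (- (s0 * x powr (- \<alpha>))) - F (y n) ^ n)"
    using u_nz ev_pos filterlim_iff[THEN iffD1, OF y_lim, rule_format, OF F_eq]
  proof eventually_elim
    case (elim n)
    have "real n * y n powr (- \<alpha>) = x powr (- \<alpha>)"
      using elim(2) \<open>x > 0\<close> \<open>\<alpha> > 0\<close> by (simp add: y_def powr_mult powr_powr powr_minus field_simps)
    then have "real n * (s (y n) * y n powr (- \<alpha>)) = s (y n) * x powr (- \<alpha>)"
      by (metis mult.left_commute)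
    also have "\<dots> = s0 * x powr (- \<alpha>) + u n"
      by (simp add: u_def algebra_simps)
    finally have "real n * (s (y n) * y n powr (- \<alpha>)) = s0 * x powr (- \<alpha>) + u n" .
    then have F_pow: "F (y n) ^ n = exp (- (s0 * x powr (- \<alpha>))) * exp (- u n)"
      using elim by (simp add: exp_of_nat_mult[symmetric] exp_add[symmetric])
    have "real n powr (\<beta> / \<alpha>) * u n * ((1 - exp (- u n)) / u n) = real n powr (\<beta> / \<alpha>) * (1 - exp (- u n))"
      using elim by simp
    then show ?case
      by (simp only: F_pow) (simp add: algebra_simps)
  qed
  ultimately have "(\<lambda>n. real n powr (\<beta> / \<alpha>) * (exp (- (s0 * x powr (- \<alpha>))) - F (y n) ^ n))
      \<longlonglongrightarrow> exp (- (s0 * x powr (- \<alpha>))) * (C1 * x powr (- (\<alpha> + \<beta>)) * 1)"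
    by (rule Lim_transform_eventually)
  then show ?thesis
    unfolding y_def by (simp only: mult_ac mult_1_right mult_1_left)
qed

text \<open>The dominating weight, used with p = \<alpha> + \<beta> and q = \<alpha> - \<gamma>:
  below 1 the exponential absorbs every power singularity at 0, and above 1 the bare power matches
  the tail hypothesis on \<open>f'\<close>.\<close>

definition tail_weight :: "real \<Rightarrow> real \<Rightarrow> real \<Rightarrow> real \<Rightarrow> real" where
  "tail_weight p q c x = x powr (- p) * (if x < 1 then exp (- (c * x powr (- q))) else 1)"

text \<open>Supplies the domination for the limit in \<open>cdf_power_asymptotics\<close>. For y >=
  x1 the mean value estimate applies, with \<open>s\<close> close to \<open>s0\<close>; for y < x1
  both terms are simply bounded by the exponential part of the weight.\<close>

lemma cdf_power_bound:
  fixes \<alpha> s0 \<beta> \<gamma> C1 C2 :: real and F s :: "real \<Rightarrow> real"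
  assumes "\<alpha> > 0" "s0 > 0" "\<beta> > 0" "C2 > 0" "0 < \<gamma>" "\<gamma> < \<alpha>" "C1 \<noteq> 0"
    and F_nonneg: "\<And>x. 0 \<le> F x"
    and F_le: "\<And>x. x > 0 \<Longrightarrow> F x \<le> exp (- (C2 * min 1 (x powr \<gamma>) * x powr (- \<alpha>)))"
    and F_eq: "\<forall>\<^sub>F y in at_top. F y = exp (- (s y * y powr (- \<alpha>)))"
    and s_asymp: "((\<lambda>y. (s y - s0) / (C1 * y powr (- \<beta>))) \<longlongrightarrow> 1) at_top"
  obtains K c where "c > 0"
    and "\<And>n x. n \<ge> 1 \<Longrightarrow> x > 0 \<Longrightarrow> real n powr (\<beta> / \<alpha>)
        * \<bar>exp (- (s0 * x powr (- \<alpha>))) - F (real n powr (1 / \<alpha>) * x) ^ n\<bar>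
      \<le> K * tail_weight (\<alpha> + \<beta>) (\<alpha> - \<gamma>) c x"
proof -
  have s_dist: "\<forall>\<^sub>F y in at_top. \<bar>s y - s0\<bar> \<le> 2 * \<bar>C1\<bar> * y powr (- \<beta>)"
    using order_tendstoD(2)[OF tendsto_rabs[OF s_asymp], of 2] eventually_gt_at_top[of 0]
  proof (simp, elim eventually_elim2)
    fix y :: real
    assume "y > 0" "\<bar>s y - s0\<bar> / \<bar>C1 * y powr (- \<beta>)\<bar> < 2"
    then show "\<bar>s y - s0\<bar> \<le> 2 * \<bar>C1\<bar> * y powr (- \<beta>)"
      using \<open>C1 \<noteq> 0\<close> by (simp add: abs_mult divide_less_eq)
  qed
  have "((\<lambda>y. 2 * \<bar>C1\<bar> * y powr (- \<beta>)) \<longlongrightarrow> 0) at_top"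
    using \<open>\<beta> > 0\<close> by real_asymp
  then have "\<forall>\<^sub>F y in at_top. 2 * \<bar>C1\<bar> * y powr (- \<beta>) < s0 / 2"
    using \<open>s0 > 0\<close> by (intro order_tendstoD) auto
  with s_dist F_eq have "\<forall>\<^sub>F y in at_top. F y = exp (- (s y * y powr (- \<alpha>)))
      \<and> \<bar>s y - s0\<bar> \<le> 2 * \<bar>C1\<bar> * y powr (- \<beta>) \<and> s y \<ge> s0 / 2"
    by eventually_elim auto
  then obtain x1 where x1: "\<And>y. y \<ge> x1 \<Longrightarrow> F y = exp (- (s y * y powr (- \<alpha>)))
      \<and> \<bar>s y - s0\<bar> \<le> 2 * \<bar>C1\<bar> * y powr (- \<beta>) \<and> s y \<ge> s0 / 2"
    by (auto simp: eventually_at_top_linorder)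
  define x0 where "x0 = max 1 x1"
  \<comment> \<open>This is at most both decay constants that occur, s0/2 beyond \<open>x1\<close>
    and C2 below it, so a single weight covers both regimes; likewise \<open>K\<close> adds up their
    constants.\<close>
  define c where "c = min C2 (s0 / 2)"
  define K where "K = 2 * \<bar>C1\<bar> + x0 powr (\<alpha> + \<beta>)"
  have "x0 \<ge> 1" "c > 0" using assms by (auto simp: x0_def c_def)
  have K: "2 * \<bar>C1\<bar> \<le> K" "x0 powr (\<alpha> + \<beta>) \<le> K" by (auto simp: K_def)
  show thesis
  proof (rule that[OF \<open>c > 0\<close>])
    fix n :: nat and x :: real
    assume n: "n \<ge> 1" and x: "x > 0"
    define y where "y = real n powr (1 / \<alpha>) * x"
    define G where "G = exp (- (s0 * x powr (- \<alpha>)))"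
    define w where "w = (if x < 1 then exp (- (c * x powr (- (\<alpha> - \<gamma>)))) else 1)"
    have "real n powr (1 / \<alpha>) \<ge> 1" using n \<open>\<alpha> > 0\<close> by (simp add: ge_one_powr_ge_zero)
    with x have "y \<ge> x" by (simp add: y_def mult_le_cancel_right1)
    with x have y: "y \<ge> x" "y > 0" by auto
    have ny: "real n * y powr (- \<alpha>) = x powr (- \<alpha>)"
      using n x \<open>\<alpha> > 0\<close> by (simp add: y_def powr_mult powr_powr powr_minus field_simps)
    have nb: "real n powr (\<beta> / \<alpha>) * y powr (- \<beta>) = x powr (- \<beta>)"
      using n x \<open>\<alpha> > 0\<close>
      by (simp add: y_def powr_mult powr_powr powr_add[symmetric] mult.assoc[symmetric])
    have x_add: "x powr (- (\<alpha> + \<beta>)) = x powr (- \<beta>) * x powr (- \<alpha>)"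
      by (simp add: powr_add[symmetric] algebra_simps)
    have x_prod: "x powr \<gamma> * x powr (- \<alpha>) = x powr (- (\<alpha> - \<gamma>))"
      by (simp add: powr_add[symmetric])
    have x_small: "x powr (- (\<alpha> - \<gamma>)) \<le> x powr (- \<alpha>)" if "x < 1"
      using that x \<open>0 < \<gamma>\<close> by (intro powr_mono') auto
    \<comment> \<open>Below 1 the exponent -\<alpha> gives the larger power of \<open>x\<close>,
      hence the faster decay.\<close>
    have G_w: "exp (- (s0 / 2 * x powr (- \<alpha>))) \<le> w"
    proof (cases "x < 1")
      case True
      have "c * x powr (- (\<alpha> - \<gamma>)) \<le> s0 / 2 * x powr (- \<alpha>)"
        using x_small[OF True] \<open>c > 0\<close> by (intro mult_mono) (auto simp: c_def)
      then show ?thesis by (simp add: w_def True)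
    qed (use \<open>s0 > 0\<close> in \<open>simp add: w_def\<close>)
    have "w > 0" by (simp add: w_def)
    have "real n powr (\<beta> / \<alpha>) * \<bar>G - F y ^ n\<bar> \<le> K * (x powr (- (\<alpha> + \<beta>)) * w)"
    proof (cases "y \<ge> x1")
      case True
      note * = x1[OF True]
      have "real n * (s y * y powr (- \<alpha>)) = s y * x powr (- \<alpha>)"
        using ny by (metis mult.left_commute)
      then have "F y ^ n = exp (- (s y * x powr (- \<alpha>)))"
        using * by (simp add: exp_of_nat_mult[symmetric])
      then have "\<bar>G - F y ^ n\<bar> \<le> \<bar>s0 * x powr (- \<alpha>) - s y * x powr (- \<alpha>)\<bar> * exp (- (s0 / 2 * x powr (- \<alpha>)))"
        unfolding G_def using * \<open>s0 > 0\<close>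
        by (simp only:) (intro abs_exp_minus_diff_le mult_right_mono; simp)
      also have "\<dots> = \<bar>s y - s0\<bar> * x powr (- \<alpha>) * exp (- (s0 / 2 * x powr (- \<alpha>)))"
        by (simp add: left_diff_distrib[symmetric] abs_mult abs_minus_commute)
      also have "\<dots> \<le> 2 * \<bar>C1\<bar> * y powr (- \<beta>) * x powr (- \<alpha>) * w"
        using * G_w by (intro mult_mono) auto
      finally have "real n powr (\<beta> / \<alpha>) * \<bar>G - F y ^ n\<bar>
          \<le> real n powr (\<beta> / \<alpha>) * (2 * \<bar>C1\<bar> * y powr (- \<beta>) * x powr (- \<alpha>) * w)"
        by (intro mult_left_mono) auto
      also have "\<dots> = 2 * \<bar>C1\<bar> * ((real n powr (\<beta> / \<alpha>) * y powr (- \<beta>)) * x powr (- \<alpha>) * w)"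
        by (simp only: mult_ac)
      also have "\<dots> = 2 * \<bar>C1\<bar> * (x powr (- (\<alpha> + \<beta>)) * w)"
        by (simp only: nb x_add)
      also have "\<dots> \<le> K * (x powr (- (\<alpha> + \<beta>)) * w)"
        using K(1) \<open>w > 0\<close> by (intro mult_right_mono) auto
      finally show ?thesis .
    next
      case False
      then have "y < x0" by (simp add: x0_def)
      \<comment> \<open>The rate is (y/x)^\<beta>, so bounded \<open>y\<close> bounds it by a
        multiple of x^(-\<beta>).\<close>
      have "real n powr (\<beta> / \<alpha>) = x powr (- \<beta>) * y powr \<beta>"
        using nb y(2) by (simp add: powr_minus field_simps)
      also have "\<dots> \<le> x powr (- \<beta>) * x0 powr \<beta>"
        using \<open>y < x0\<close> y(2) \<open>\<beta> > 0\<close> by (intro mult_left_mono powr_mono2) auto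
      finally have rate: "real n powr (\<beta> / \<alpha>) \<le> x powr (- \<beta>) * x0 powr \<beta>" .
      have F_w: "F y ^ n \<le> w"
      proof -
        have "F y ^ n \<le> exp (- (C2 * min 1 (y powr \<gamma>) * y powr (- \<alpha>))) ^ n"
          using F_le[OF y(2)] F_nonneg by (intro power_mono)
        also have "\<dots> = exp (- (C2 * min 1 (y powr \<gamma>) * (real n * y powr (- \<alpha>))))"
          by (simp add: exp_of_nat_mult[symmetric] mult_ac)
        also have "\<dots> \<le> w"
        proof (cases "x < 1")
          case True
          \<comment> \<open>As \<open>x \<le> y\<close>, the lower bound at \<open>y\<close> may be
            replaced by one in terms of \<open>x\<close> alone, which makes the decay uniform in
            \<open>n\<close>.\<close>
          have "x powr \<gamma> \<le> min 1 (y powr \<gamma>)"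
            using True x y \<open>0 < \<gamma>\<close> by (auto intro: powr_mono2 powr_le1)
          then have "c * (x powr \<gamma> * x powr (- \<alpha>)) \<le> C2 * (min 1 (y powr \<gamma>) * x powr (- \<alpha>))"
            using \<open>c > 0\<close> by (intro mult_mono) (auto simp: c_def)
          then show ?thesis by (simp add: w_def True ny x_prod mult.assoc)
        qed (use \<open>C2 > 0\<close> in \<open>simp add: w_def\<close>)
        finally show ?thesis .
      qed
      have "G \<le> exp (- (s0 / 2 * x powr (- \<alpha>)))"
        unfolding G_def using \<open>s0 > 0\<close> by simp
      then have "G \<le> w" using G_w by linarith
      moreover have "0 \<le> F y ^ n" "0 \<le> G" using F_nonneg by (auto simp: G_def)
      ultimately have "\<bar>G - F y ^ n\<bar> \<le> w" using F_w by linarith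
      with rate have "real n powr (\<beta> / \<alpha>) * \<bar>G - F y ^ n\<bar> \<le> (x powr (- \<beta>) * x0 powr \<beta>) * w"
        by (intro mult_mono) auto
      also have "\<dots> \<le> (x powr (- (\<alpha> + \<beta>)) * x0 powr (\<alpha> + \<beta>)) * w"
      proof -
        \<comment> \<open>The missing factor x^(-\<alpha>) is inserted at the cost of x0^\<alpha>,
          because x <= y < x0.\<close>
        have "x powr \<alpha> \<le> x0 powr \<alpha>"
          using x y \<open>y < x0\<close> \<open>\<alpha> > 0\<close> by (intro powr_mono2) auto
        then have "1 \<le> x powr (- \<alpha>) * x0 powr \<alpha>"
          using x by (simp add: powr_minus field_simps)
        then have "(x powr (- \<beta>) * x0 powr \<beta>) * 1
            \<le> (x powr (- \<beta>) * x0 powr \<beta>) * (x powr (- \<alpha>) * x0 powr \<alpha>)"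
          by (rule mult_left_mono) simp
        moreover have "x0 powr (\<alpha> + \<beta>) = x0 powr \<alpha> * x0 powr \<beta>"
          by (rule powr_add)
        ultimately have "x powr (- \<beta>) * x0 powr \<beta> \<le> x powr (- (\<alpha> + \<beta>)) * x0 powr (\<alpha> + \<beta>)"
          by (simp only: x_add mult_ac mult_1_right)
        then show ?thesis
          using \<open>w > 0\<close> by (intro mult_right_mono) auto
      qed
      also have "\<dots> \<le> K * (x powr (- (\<alpha> + \<beta>)) * w)"
        using mult_right_mono[OF K(2), of "x powr (- (\<alpha> + \<beta>)) * w"] \<open>w > 0\<close>
        by (simp add: mult_ac)
      finally show ?thesis .
    qed
    then show "real n powr (\<beta> / \<alpha>)
        * \<bar>exp (- (s0 * x powr (- \<alpha>))) - F (real n powr (1 / \<alpha>) * x) ^ n\<bar>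
      \<le> K * tail_weight (\<alpha> + \<beta>) (\<alpha> - \<gamma>) c x"
      by (simp add: G_def y_def w_def tail_weight_def)
  qed
qed

section \<open>From extended-real to real exponents\<close>

lemma eexp_le_exp:
  assumes "ereal F = eexp (- (s * ereal p))" and "ereal c \<le> s" and "p > 0"
  shows "F \<le> exp (- (c * p))"
  \<comment> \<open>For \<open>s = \<infinity>\<close> the convention makes \<open>F\<close> zero;
    the lower bound excludes the other infinite value.\<close>
  using assms by (cases s) (auto simp: eexp_def zero_ereal_def)

text \<open>Dividing \<infinity> by a nonzero real gives an infinite value, so a ratio between 0 and
  2 rules out \<open>S x = \<infinity>\<close>, and the lower bound rules out -\<infinity>. For
  large \<open>x\<close> everything is therefore real.\<close>

lemma eexp_real_asymptotics:
  fixes S :: "real \<Rightarrow> ereal" and F h :: "real \<Rightarrow> real"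
  assumes F_eq: "\<And>x. x > 0 \<Longrightarrow> ereal (F x) = eexp (- (S x * ereal (p x)))"
    and lower: "\<And>x. x > 0 \<Longrightarrow> ereal (l x) \<le> S x"
    and h: "\<And>x. x > 0 \<Longrightarrow> h x \<noteq> 0"
    and asymp: "((\<lambda>x. (S x - ereal a) / ereal (h x)) \<longlongrightarrow> 1) at_top"
  shows "\<forall>\<^sub>F x in at_top. F x = exp (- (real_of_ereal (S x) * p x))"
    and "((\<lambda>x. (real_of_ereal (S x) - a) / h x) \<longlongrightarrow> 1) at_top"
proof -
  have ev: "\<forall>\<^sub>F x in at_top. x > 0 \<and> \<bar>S x\<bar> \<noteq> \<infinity>"
  proof -
    have "\<forall>\<^sub>F x in at_top. 0 < (S x - ereal a) / ereal (h x)"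
      "\<forall>\<^sub>F x in at_top. (S x - ereal a) / ereal (h x) < 2"
      using order_tendstoD[OF asymp] by simp_all
    then show ?thesis
      using eventually_gt_at_top[of 0]
    proof eventually_elim
      case (elim x)
      show ?case
      proof (cases "S x")
        case PInf
        then show ?thesis
          using elim h[of x] by (cases "h x > 0") (auto simp: divide_ereal_def)
      qed (use elim lower[of x] in auto)
    qed
  qed
  show "\<forall>\<^sub>F x in at_top. F x = exp (- (real_of_ereal (S x) * p x))"
    using ev
  proof eventually_elim
    case (elim x)
    then obtain r where r: "S x = ereal r" by (cases "S x") auto
    then show ?case using F_eq[of x] elim by (simp add: eexp_def)
  qed
  have "((\<lambda>x. ereal ((real_of_ereal (S x) - a) / h x)) \<longlongrightarrow> 1) at_top"
  proof (rule Lim_transform_eventually[OF asymp])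
    show "\<forall>\<^sub>F x in at_top. (S x - ereal a) / ereal (h x) = ereal ((real_of_ereal (S x) - a) / h x)"
      using ev
    proof eventually_elim
      case (elim x)
      then obtain r where r: "S x = ereal r" by (cases "S x") auto
      then show ?case using h[of x] elim by simp
    qed
  qed
  then show "((\<lambda>x. (real_of_ereal (S x) - a) / h x) \<longlongrightarrow> 1) at_top"
    by (simp add: one_ereal_def)
qed

section \<open>Integrability of the weighted derivative\<close>

text \<open>The exponential beats every power at 0, so the product tends to 0 there; on the
  remaining compact interval continuity bounds it.\<close>

lemma powr_mult_exp_bounded:
  fixes p q c :: real
  assumes "q < 0" and "c > 0"
  obtains K where "\<And>x. 0 < x \<Longrightarrow> x \<le> 1 \<Longrightarrow> x powr p * exp (- (c * x powr q)) \<le> K"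
proof -
  let ?f = "\<lambda>x::real. x powr p * exp (- (c * x powr q))"
  have "(?f \<longlongrightarrow> 0) (at_right 0)"
    using assms by real_asymp
  then have "eventually (\<lambda>x. ?f x < 1) (at_right 0)"
    by (rule order_tendstoD) simp
  then obtain b where b: "b > 0" "\<And>x. 0 < x \<Longrightarrow> x < b \<Longrightarrow> ?f x < 1"
    by (auto simp: eventually_at_right_field)
  have "continuous_on {b..1} ?f"
    using b(1) by (intro continuous_intros) auto
  then have "bounded (?f ` {b..1})"
    by (intro compact_imp_bounded compact_continuous_image compact_Icc)
  then obtain B where B: "\<And>x. x \<in> {b..1} \<Longrightarrow> norm (?f x) \<le> B"
    unfolding bounded_iff by blast
  show thesis
  proof (rule that[of "max 1 B"])
    fix x :: real assume x: "0 < x" "x \<le> 1"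
    show "?f x \<le> max 1 B"
    proof (cases "x < b")
      case True
      then show ?thesis using b(2)[OF x(1)] by simp
    next
      case False
      then show ?thesis using B[of x] x by simp
    qed
  qed
qed

section \<open>Almost everywhere bounds on the derivative\<close>

lemma esssup_lebesgue_on_AE:
  fixes g :: "real \<Rightarrow> ereal"
  assumes "S \<in> sets lebesgue" and "esssup (lebesgue_on S) g \<le> c"
  shows "AE x in lebesgue. x \<in> S \<longrightarrow> g x \<le> c"
proof -
  have "AE x in lebesgue_on S. g x \<le> c"
    using esssup_AE[of g "lebesgue_on S"]
    by eventually_elim (rule order_trans[OF _ assms(2)])
  then show ?thesis
    using assms(1) by (simp add: AE_restrict_space_iff)
qed

text \<open>Near 0 the sum is below 1 and its first summand is nonnegative, so the essential
  supremum at one point \<open>a\<close> bounds \<open>f'\<close> almost everywhere on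
  (0,a].\<close>

lemma deriv_bound_at_0:
  fixes f f' :: "real \<Rightarrow> real"
  assumes "((\<lambda>x. ereal (x powr m * \<bar>f x\<bar>)
            + esssup (lebesgue_on {0<..x}) (\<lambda>y. ereal (y powr m * \<bar>f' y\<bar>))) \<longlongrightarrow> 0) (at_right 0)"
  obtains a where "a > 0" and "AE y in lebesgue. 0 < y \<and> y \<le> a \<longrightarrow> y powr m * \<bar>f' y\<bar> \<le> 1"
proof -
  have "\<forall>\<^sub>F x in at_right 0. ereal (x powr m * \<bar>f x\<bar>)
            + esssup (lebesgue_on {0<..x}) (\<lambda>y. ereal (y powr m * \<bar>f' y\<bar>)) < 1"
    using order_tendstoD(2)[OF assms, of 1] by simp
  then obtain b where b: "b > 0" "\<And>x. 0 < x \<Longrightarrow> x < b \<Longrightarrow> ereal (x powr m * \<bar>f x\<bar>)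
            + esssup (lebesgue_on {0<..x}) (\<lambda>y. ereal (y powr m * \<bar>f' y\<bar>)) < 1"
    by (auto simp: eventually_at_right_field)
  define a where "a = b / 2"
  have a: "a > 0" "a < b" using b(1) by (auto simp: a_def)
  have "esssup (lebesgue_on {0<..a}) (\<lambda>y. ereal (y powr m * \<bar>f' y\<bar>))
      \<le> ereal (a powr m * \<bar>f a\<bar>) + esssup (lebesgue_on {0<..a}) (\<lambda>y. ereal (y powr m * \<bar>f' y\<bar>))"
    using add_increasing[of "ereal (a powr m * \<bar>f a\<bar>)"] by simp
  also have "\<dots> \<le> 1" using b(2)[OF a] by simp
  finally have "AE y in lebesgue. y \<in> {0<..a} \<longrightarrow> ereal (y powr m * \<bar>f' y\<bar>) \<le> 1"
    by (intro esssup_lebesgue_on_AE) auto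
  then have "AE y in lebesgue. 0 < y \<and> y \<le> a \<longrightarrow> y powr m * \<bar>f' y\<bar> \<le> 1"
    by eventually_elim (auto simp: one_ereal_def)
  with a(1) show thesis by (rule that)
qed

text \<open>The essential suprema over \<open>{k..}\<close> for natural \<open>k\<close> suffice: on \<open>{k..k + 1}\<close> the powers
  of \<open>k\<close> and of \<open>y\<close> are comparable.\<close>

lemma deriv_bound_at_top:
  fixes f f' :: "real \<Rightarrow> real"
  assumes "\<delta> > 0" and lim: "((\<lambda>x. ereal (x powr (- \<alpha>) * \<bar>f x\<bar>)
            + ereal (x powr (1 + \<delta>)) *
              esssup (lebesgue_on {x..}) (\<lambda>y. ereal (y powr (- \<alpha>) * \<bar>f' y\<bar>))) \<longlongrightarrow> 0) at_top"
  obtains b where "b \<ge> 1"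
    and "AE y in lebesgue. y \<ge> b \<longrightarrow> y powr (- \<alpha>) * \<bar>f' y\<bar> \<le> 2 powr (1 + \<delta>) * y powr (- (1 + \<delta>))"
proof -
  let ?E = "\<lambda>x. esssup (lebesgue_on {x..}) (\<lambda>y. ereal (y powr (- \<alpha>) * \<bar>f' y\<bar>))"
  have "\<forall>\<^sub>F x in at_top. ereal (x powr (- \<alpha>) * \<bar>f x\<bar>) + ereal (x powr (1 + \<delta>)) * ?E x < 1"
    using order_tendstoD(2)[OF lim, of 1] by simp
  then obtain c where c: "\<And>x. x \<ge> c \<Longrightarrow>
      ereal (x powr (- \<alpha>) * \<bar>f x\<bar>) + ereal (x powr (1 + \<delta>)) * ?E x < 1"
    by (auto simp: eventually_at_top_linorder)
  have E: "?E x \<le> ereal (x powr (- (1 + \<delta>)))" if "x \<ge> c" "x > 0" for x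
  proof -
    have "ereal (x powr (1 + \<delta>)) * ?E x
        \<le> ereal (x powr (- \<alpha>) * \<bar>f x\<bar>) + ereal (x powr (1 + \<delta>)) * ?E x"
      using add_increasing[of "ereal (x powr (- \<alpha>) * \<bar>f x\<bar>)"] by simp
    also have "\<dots> \<le> 1" using c[OF that(1)] by simp
    finally have *: "ereal (x powr (1 + \<delta>)) * ?E x \<le> 1" .
    have le: "e \<le> ereal (1 / p)" if "ereal p * e \<le> 1" "p > 0" for p e
      using that by (cases e) (auto simp: one_ereal_def field_simps)
    have "x powr (- (1 + \<delta>)) = 1 / x powr (1 + \<delta>)"
      by (rule powr_minus_divide)
    then show ?thesis
      using that by (simp only:) (intro le *, simp)
  qed
  \<comment> \<open>For y >= b the integer part k of y is then at least \<open>max 1 c\<close>. From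
    k >= 1 follows y < k + 1 <= 2k, whence the factor 2^(1+\<delta>).\<close>
  define b where "b = max 1 c + 1"
  have "AE y in lebesgue. y \<in> {real k..} \<longrightarrow>
      ereal (y powr (- \<alpha>) * \<bar>f' y\<bar>) \<le> ereal (real k powr (- (1 + \<delta>)))"
    if "real k \<ge> max 1 c" for k
    using that by (intro esssup_lebesgue_on_AE E) auto
  then have "AE y in lebesgue. \<forall>k. real k \<ge> max 1 c \<longrightarrow> y \<in> {real k..} \<longrightarrow>
      ereal (y powr (- \<alpha>) * \<bar>f' y\<bar>) \<le> ereal (real k powr (- (1 + \<delta>)))"
    by (subst AE_all_countable) (auto intro!: AE_impI)
  then have "AE y in lebesgue. y \<ge> b
      \<longrightarrow> y powr (- \<alpha>) * \<bar>f' y\<bar> \<le> 2 powr (1 + \<delta>) * y powr (- (1 + \<delta>))"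
  proof eventually_elim
    case (elim y)
    show ?case
    proof
      assume "y \<ge> b"
      define k where "k = nat \<lfloor>y\<rfloor>"
      have k: "real k \<le> y" "y < real k + 1" "real k \<ge> max 1 c"
        using \<open>y \<ge> b\<close> by (auto simp: k_def b_def) linarith+
      have "y powr (- \<alpha>) * \<bar>f' y\<bar> \<le> real k powr (- (1 + \<delta>))"
        using elim k by auto
      also have "\<dots> \<le> (y / 2) powr (- (1 + \<delta>))"
        using k \<open>\<delta> > 0\<close> by (intro powr_mono2') auto
      also have "\<dots> = 2 powr (1 + \<delta>) * y powr (- (1 + \<delta>))"
      proof -
        have "(y / 2) powr (- (1 + \<delta>)) = y powr (- (1 + \<delta>)) / 2 powr (- (1 + \<delta>))"
          by (rule powr_divide)
        also have "2 powr (- (1 + \<delta>)) = 1 / 2 powr (1 + \<delta>)"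
          by (rule powr_minus_divide)
        finally show ?thesis by simp
      qed
      finally show "y powr (- \<alpha>) * \<bar>f' y\<bar> \<le> 2 powr (1 + \<delta>) * y powr (- (1 + \<delta>))" .
    qed
  qed
  moreover have "b \<ge> 1" by (simp add: b_def)
  ultimately show thesis using that by blast
qed

section \<open>Integrability against weights that decay fast at 0\<close>

lemma set_integrable_near_0:
  fixes g \<phi> :: "real \<Rightarrow> real"
  assumes [measurable]: "g \<in> borel_measurable borel" "\<phi> \<in> borel_measurable borel"
    and "a > 0" and g_bound: "AE y in lborel. 0 < y \<and> y \<le> a \<longrightarrow> y powr m * \<bar>g y\<bar> \<le> 1"
    and g_int: "\<And>a b. 0 < a \<Longrightarrow> a \<le> b \<Longrightarrow> set_integrable lborel {a..b} g"
    and \<phi>: "\<And>x. 0 < x \<Longrightarrow> x \<le> 1 \<Longrightarrow> \<bar>\<phi> x\<bar> \<le> K"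
      "\<And>x. 0 < x \<Longrightarrow> x \<le> 1 \<Longrightarrow> x powr (- m) * \<bar>\<phi> x\<bar> \<le> K"
  shows "set_integrable lborel {0<..1} (\<lambda>x. g x * \<phi> x)"
proof -
  \<comment> \<open>On (0,c) the hypothesis reads |g(x)| <= x^(-m), and the second bound on
    \<open>\<phi>\<close> makes the product at most \<open>K\<close>. On [c,1] the first bound
    leaves a multiple of the integrable |g|.\<close>
  define c where "c = min a 1"
  have c: "0 < c" "c \<le> 1" using \<open>a > 0\<close> by (auto simp: c_def)
  have "K \<ge> 0" using \<phi>(1)[of 1] by simp
  have dom: "integrable lborel (\<lambda>x. indicator {0..1} x * K + K * (indicator {c..1} x * \<bar>g x\<bar>))"
    using integrable_abs[OF g_int[OF c, unfolded set_integrable_def]]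
    by (intro Bochner_Integration.integrable_add integrable_mult_right)
      (auto simp: abs_mult integrable_real_indicator)
  show ?thesis
    unfolding set_integrable_def
  proof (rule Bochner_Integration.integrable_bound[OF dom])
    show "AE x in lborel. norm (indicator {0<..1} x *\<^sub>R (g x * \<phi> x))
        \<le> norm (indicator {0..1} x * K + K * (indicator {c..1} x * \<bar>g x\<bar>))"
      using g_bound
    proof eventually_elim
      case (elim x)
      show ?case
      proof (cases "0 < x \<and> x \<le> 1")
        case x: True
        show ?thesis
        proof (cases "x < c")
          case True
          then have "x powr m * \<bar>g x\<bar> \<le> 1" using elim x by (auto simp: c_def)
          then have "(x powr m * \<bar>g x\<bar>) * (x powr (- m) * \<bar>\<phi> x\<bar>) \<le> 1 * K"
            using \<phi>(2)[of x] x by (intro mult_mono) simp_all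
          moreover have "(x powr m * \<bar>g x\<bar>) * (x powr (- m) * \<bar>\<phi> x\<bar>)
              = (x powr m * x powr (- m)) * \<bar>g x * \<phi> x\<bar>"
            by (simp only: abs_mult mult_ac)
          moreover have "x powr m * x powr (- m) = 1"
            using x by (simp add: powr_add[symmetric])
          ultimately have "\<bar>g x * \<phi> x\<bar> \<le> K"
            by (simp only: mult_1_left)
          then show ?thesis
            using x True \<open>K \<ge> 0\<close> by (simp add: indicator_def)
        next
          case False
          have "\<bar>g x * \<phi> x\<bar> \<le> K * \<bar>g x\<bar>"
            using mult_right_mono[OF \<phi>(1)[of x], of "\<bar>g x\<bar>"] x by (simp add: abs_mult mult.commute)
          then show ?thesis
            using x False \<open>K \<ge> 0\<close> by (simp add: indicator_def)
        qed
      next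
        case False
        then have "indicator {0<..1} x = (0 :: real)" by (simp add: indicator_def)
        then show ?thesis by (simp only: scaleR_zero_left norm_zero norm_ge_zero)
      qed
    qed
  qed measurable
qed

lemma set_integrable_Ioi_split:
  fixes h :: "real \<Rightarrow> real"
  assumes "set_integrable lborel {0<..1} h" and "set_integrable lborel {1..} h"
  shows "set_integrable lborel {0<..} h"
proof -
  have "{0<..} = {0<..1} \<union> {1::real..}" by auto
  then show ?thesis using set_integrable_Un[OF assms] by simp
qed

text \<open>The exponential bounds not only x^(-p) but also x^(-m-p), which compensates the growth
  x^(-m) allowed to \<open>g\<close> at 0, whatever the sign of \<open>m\<close>.\<close>

lemma exp_weight_integrable_near_0:
  fixes g :: "real \<Rightarrow> real"
  assumes [measurable]: "g \<in> borel_measurable borel" and "q > 0" "c > 0"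
    and g_bound: "a > 0" "AE y in lborel. 0 < y \<and> y \<le> a \<longrightarrow> y powr m * \<bar>g y\<bar> \<le> 1"
    and g_int: "\<And>a b. 0 < a \<Longrightarrow> a \<le> b \<Longrightarrow> set_integrable lborel {a..b} g"
  shows "set_integrable lborel {0<..1} (\<lambda>x. g x * (x powr (- p) * exp (- (c * x powr (- q)))))"
proof -
  obtain K1 where K1: "\<And>x. 0 < x \<Longrightarrow> x \<le> 1 \<Longrightarrow> x powr (- p) * exp (- (c * x powr (- q))) \<le> K1"
    using powr_mult_exp_bounded[of "- q" c "- p"] \<open>q > 0\<close> \<open>c > 0\<close> by auto
  obtain K2 where K2: "\<And>x. 0 < x \<Longrightarrow> x \<le> 1 \<Longrightarrow> x powr (- m - p) * exp (- (c * x powr (- q))) \<le> K2"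
    using powr_mult_exp_bounded[of "- q" c "- m - p"] \<open>q > 0\<close> \<open>c > 0\<close> by auto
  show ?thesis
  proof (rule set_integrable_near_0[OF _ _ g_bound g_int])
    fix x :: real assume x: "0 < x" "x \<le> 1"
    have "x powr (- m) * x powr (- p) = x powr (- m - p)"
      by (simp add: powr_add[symmetric])
    then show "\<bar>x powr (- p) * exp (- (c * x powr (- q)))\<bar> \<le> max K1 K2"
      "x powr (- m) * \<bar>x powr (- p) * exp (- (c * x powr (- q)))\<bar> \<le> max K1 K2"
      using K1[OF x] K2[OF x] by (auto simp: abs_mult mult.assoc[symmetric])
  qed auto
qed

lemma tail_weight_integrable:
  fixes g :: "real \<Rightarrow> real"
  assumes g[measurable]: "g \<in> borel_measurable borel" and "q > 0" "c > 0"
    and g_bound: "a > 0" "AE y in lborel. 0 < y \<and> y \<le> a \<longrightarrow> y powr m * \<bar>g y\<bar> \<le> 1"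
    and g_int: "\<And>a b. 0 < a \<Longrightarrow> a \<le> b \<Longrightarrow> set_integrable lborel {a..b} g"
    and tail: "set_integrable lborel {1..} (\<lambda>x. x powr (- p) * g x)"
  shows "set_integrable lborel {0<..} (\<lambda>x. g x * tail_weight p q c x)"
proof (rule set_integrable_Ioi_split)
  have "indicator {1..} x *\<^sub>R (x powr (- p) * g x)
      = indicator {1..} x *\<^sub>R (g x * tail_weight p q c x)" for x :: real
    by (simp add: tail_weight_def indicator_def)
  then show "set_integrable lborel {1..} (\<lambda>x. g x * tail_weight p q c x)"
    using tail unfolding set_integrable_def by (simp only:)
  have near_0: "set_integrable lborel {0<..1}
      (\<lambda>x. g x * (x powr (- p) * exp (- (c * x powr (- q)))))"
    by (rule exp_weight_integrable_near_0[OF g \<open>q > 0\<close> \<open>c > 0\<close> g_bound]) (rule g_int)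
  \<comment> \<open>\<open>tail_weight\<close> drops the exponential already at x = 1, so the
    integrands may differ at that null point.\<close>
  have ae: "AE x in lborel. indicator {0<..1} x *\<^sub>R (g x * (x powr (- p) * exp (- (c * x powr (- q)))))
      = indicator {0<..1} x *\<^sub>R (g x * tail_weight p q c x)"
    using AE_lborel_singleton[of 1]
    by eventually_elim (auto simp: tail_weight_def indicator_def)
  have "(\<lambda>x. indicator {0<..1} x *\<^sub>R (g x * tail_weight p q c x)) \<in> borel_measurable lborel"
    unfolding tail_weight_def by measurable
  from integrable_cong_AE_imp[OF near_0[unfolded set_integrable_def] this ae]
  show "set_integrable lborel {0<..1} (\<lambda>x. g x * tail_weight p q c x)"
    unfolding set_integrable_def .
qed

text \<open>This is the integrand of the by-parts formula for \<open>Z\<close>. Below 1 the bracket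
  is minus the Frechet distribution function, which decays exponentially at 0. From 1 on it is 1 -
  exp(-t) <= t with t = s0 x^(-\<alpha>), and the bound on \<open>g\<close> leaves the integrable
  power x^(-(1+\<delta>)).\<close>

lemma frechet_tail_integrable:
  fixes g :: "real \<Rightarrow> real"
  assumes g[measurable]: "g \<in> borel_measurable borel" and "\<alpha> > 0" "s0 > 0" "\<delta> > 0"
    and g_bound: "a > 0" "AE y in lborel. 0 < y \<and> y \<le> a \<longrightarrow> y powr m * \<bar>g y\<bar> \<le> 1"
    and g_int: "\<And>a b. 0 < a \<Longrightarrow> a \<le> b \<Longrightarrow> set_integrable lborel {a..b} g"
    and "b \<ge> 1"
    and g_top: "AE y in lborel. y \<ge> b \<longrightarrow> y powr (- \<alpha>) * \<bar>g y\<bar> \<le> C * y powr (- (1 + \<delta>))"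
  shows "set_integrable lborel {0<..}
    (\<lambda>x. g x * (indicator {1..} x - exp (- (s0 * x powr (- \<alpha>)))))"
proof (rule set_integrable_Ioi_split)
  let ?h = "\<lambda>x. g x * (indicator {1..} x - exp (- (s0 * x powr (- \<alpha>))))"
  have "set_integrable lborel {0<..1}
      (\<lambda>x. g x * (x powr (- 0) * exp (- (s0 * x powr (- \<alpha>)))))"
    by (rule exp_weight_integrable_near_0[OF g \<open>\<alpha> > 0\<close> \<open>s0 > 0\<close> g_bound]) (rule g_int)
  then have near_0': "integrable lborel
      (\<lambda>x. - (indicator {0<..1} x *\<^sub>R (g x * (x powr (- 0) * exp (- (s0 * x powr (- \<alpha>)))))))"
    unfolding set_integrable_def by (rule Bochner_Integration.integrable_minus)
  have ae: "AE x in lborel. - (indicator {0<..1} x *\<^sub>R (g x * (x powr (- 0) * exp (- (s0 * x powr (- \<alpha>))))))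
      = indicator {0<..1} x *\<^sub>R ?h x"
    using AE_lborel_singleton[of 1] by eventually_elim (auto simp: indicator_def)
  have "(\<lambda>x. indicator {0<..1} x *\<^sub>R ?h x) \<in> borel_measurable lborel"
    by measurable
  from integrable_cong_AE_imp[OF near_0' this ae]
  show "set_integrable lborel {0<..1} ?h"
    unfolding set_integrable_def .
  have "((\<lambda>x. x powr (- (1 + \<delta>))) has_integral - (b powr (- (1 + \<delta>) + 1) / (- (1 + \<delta>) + 1))) {b..}"
    using has_integral_powr_to_inf[of "- (1 + \<delta>)" b] \<open>\<delta> > 0\<close> \<open>b \<ge> 1\<close> by simp
  then have "(\<lambda>x. x powr (- (1 + \<delta>))) absolutely_integrable_on {b..}"
    by (intro nonnegative_absolutely_integrable_1) auto
  then have powr_int: "integrable lborel (\<lambda>x. indicator {b..} x * x powr (- (1 + \<delta>)))"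
    by (simp add: set_integrable_def integrable_completion)
  have dom: "integrable lborel (\<lambda>x. indicator {1..b} x * \<bar>g x\<bar>
      + s0 * C * (indicator {b..} x * x powr (- (1 + \<delta>))))"
    using integrable_abs[OF g_int[of 1 b, unfolded set_integrable_def]] \<open>b \<ge> 1\<close>
    by (intro Bochner_Integration.integrable_add integrable_mult_right powr_int) (auto simp: abs_mult)
  show "set_integrable lborel {1..} ?h"
    unfolding set_integrable_def
  proof (rule Bochner_Integration.integrable_bound[OF dom])
    show "AE x in lborel. norm (indicator {1..} x *\<^sub>R ?h x) \<le> norm (indicator {1..b} x * \<bar>g x\<bar>
      + s0 * C * (indicator {b..} x * x powr (- (1 + \<delta>))))"
      using g_top
    proof eventually_elim
      case (elim x)
      let ?t = "1 - exp (- (s0 * x powr (- \<alpha>)))"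
      show ?case
      proof (cases "x \<ge> 1")
        case x: True
        have t: "0 \<le> ?t" "?t \<le> 1" "?t \<le> s0 * x powr (- \<alpha>)"
          using exp_ge_add_one_self[of "- (s0 * x powr (- \<alpha>))"] \<open>s0 > 0\<close> by auto
        have h: "\<bar>?h x\<bar> = \<bar>g x\<bar> * ?t" using x t by (simp add: abs_mult)
        show ?thesis
        proof (cases "x < b")
          case True
          have "\<bar>g x\<bar> * ?t \<le> \<bar>g x\<bar>" using t by (intro mult_left_le) auto
          then show ?thesis using x True h by simp
        next
          case False
          have "\<bar>g x\<bar> * ?t \<le> \<bar>g x\<bar> * (s0 * x powr (- \<alpha>))"
            using t by (intro mult_left_mono) auto
          also have "\<dots> = s0 * (x powr (- \<alpha>) * \<bar>g x\<bar>)" by (simp only: mult_ac)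
          also have "\<dots> \<le> s0 * (C * x powr (- (1 + \<delta>)))"
            using elim False \<open>s0 > 0\<close> by (intro mult_left_mono) auto
          finally have le: "\<bar>?h x\<bar> \<le> s0 * C * x powr (- (1 + \<delta>))"
            using h by simp
          show ?thesis
            using le x False abs_ge_self order_trans by (auto simp: indicator_def)
        qed
      qed simp
    qed
  qed measurable
qed

section \<open>Convergence of the expectations\<close>

text \<open>Dominated convergence with dominating function |K g w|. The same bound, divided by
  \<open>\<rho> n\<close>, makes each single difference integrable.\<close>

lemma scaled_set_integral_tendsto:
  fixes g G w L :: "real \<Rightarrow> real" and H :: "nat \<Rightarrow> real \<Rightarrow> real" and \<rho> :: "nat \<Rightarrow> real"
  assumes [measurable]: "g \<in> borel_measurable borel" "G \<in> borel_measurable borel"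
      "\<And>n. H n \<in> borel_measurable borel" "L \<in> borel_measurable borel" "S \<in> sets borel"
    and gw: "set_integrable lborel S (\<lambda>x. g x * w x)"
    and \<rho>: "\<And>n. n \<ge> 1 \<Longrightarrow> \<rho> n > 0"
    and bound: "\<And>n x. n \<ge> 1 \<Longrightarrow> x \<in> S \<Longrightarrow> \<rho> n * \<bar>G x - H n x\<bar> \<le> K * w x"
    and lim: "\<And>x. x \<in> S \<Longrightarrow> (\<lambda>n. \<rho> n * (G x - H n x)) \<longlonglongrightarrow> L x"
  shows "n \<ge> 1 \<Longrightarrow> set_integrable lborel S (\<lambda>x. g x * (G x - H n x))"
    and "set_integrable lborel S (\<lambda>x. g x * L x)"
    and "(\<lambda>n. \<rho> n * (LINT x:S|lborel. g x * (G x - H n x))) \<longlonglongrightarrow> (LINT x:S|lborel. g x * L x)"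
proof -
  \<comment> \<open>The bounds hold from n = 1 on; the shift to \<open>Suc n\<close> makes them hold
    along the whole sequence.\<close>
  define h where "h n x = indicator S x * (g x * (\<rho> (Suc n) * (G x - H (Suc n) x)))" for n x
  have [measurable]: "h n \<in> borel_measurable borel" for n
    unfolding h_def by measurable
  have dom: "integrable lborel (\<lambda>x. \<bar>K * (indicator S x * (g x * w x))\<bar>)"
    using gw by (intro integrable_abs integrable_mult_right) (simp add: set_integrable_def)
  have h_le: "norm (h n x) \<le> \<bar>K * (indicator S x * (g x * w x))\<bar>" for n x
  proof (cases "x \<in> S")
    case True
    have "\<rho> (Suc n) * \<bar>G x - H (Suc n) x\<bar> \<le> K * w x"
      using bound True by simp
    then have "\<bar>g x\<bar> * (\<rho> (Suc n) * \<bar>G x - H (Suc n) x\<bar>) \<le> \<bar>g x\<bar> * \<bar>K * w x\<bar>"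
      by (intro mult_left_mono) auto
    moreover have "norm (h n x) = \<bar>g x\<bar> * (\<rho> (Suc n) * \<bar>G x - H (Suc n) x\<bar>)"
      using True \<rho>[of "Suc n"] by (simp add: h_def abs_mult)
    ultimately show ?thesis
      using True by (simp add: abs_mult mult_ac)
  qed (simp add: h_def)
  have lim_h: "(\<lambda>n. h n x) \<longlonglongrightarrow> indicator S x * (g x * L x)" for x
  proof (cases "x \<in> S")
    case True
    from lim[OF this] show ?thesis
      using True unfolding h_def
      by (intro tendsto_mult_left) (rule LIMSEQ_Suc)
  qed (simp add: h_def)
  have meas: "(\<lambda>x. indicator S x * (g x * L x)) \<in> borel_measurable lborel"
    "\<And>n. h n \<in> borel_measurable lborel"
    by measurable
  note dominated = meas dom AE_I2[OF lim_h] AE_I2[OF h_le]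
  show "set_integrable lborel S (\<lambda>x. g x * L x)"
    unfolding set_integrable_def using integrable_dominated_convergence[OF dominated] by simp
  have h_int: "integrable lborel (h n)" for n
    by (rule integrable_dominated_convergence2[OF dominated])
  have h_eq: "(LINT x|lborel. h n x)
      = \<rho> (Suc n) * (LINT x:S|lborel. g x * (G x - H (Suc n) x))" for n
  proof -
    have "h n = (\<lambda>x. \<rho> (Suc n) * (indicator S x *\<^sub>R (g x * (G x - H (Suc n) x))))"
      by (simp add: h_def fun_eq_iff)
    then show ?thesis
      unfolding set_lebesgue_integral_def by (simp only: integral_mult_right_zero)
  qed
  have "(\<lambda>n. LINT x|lborel. h n x) \<longlonglongrightarrow> (LINT x:S|lborel. g x * L x)"
    unfolding set_lebesgue_integral_def using integral_dominated_convergence[OF dominated] by simp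
  then show "(\<lambda>n. \<rho> n * (LINT x:S|lborel. g x * (G x - H n x))) \<longlonglongrightarrow> (LINT x:S|lborel. g x * L x)"
    unfolding h_eq by (rule LIMSEQ_imp_Suc)
  show "set_integrable lborel S (\<lambda>x. g x * (G x - H n x))" if "n \<ge> 1"
  proof -
    obtain k where k: "n = Suc k" using \<open>n \<ge> 1\<close> by (cases n) auto
    have "integrable lborel (\<lambda>x. inverse (\<rho> n) * h k x)"
      by (intro integrable_mult_right h_int)
    moreover have "inverse (\<rho> n) * h k x = indicator S x * (g x * (G x - H n x))" for x
      using \<rho>[OF \<open>n \<ge> 1\<close>] by (simp add: h_def k field_simps)
    ultimately show ?thesis by (simp add: set_integrable_def)
  qed
qed

text \<open>Integrals of non-integrable functions default to 0, so the conclusion also asserts that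
  the expectations and the limiting integral exist.\<close>

theorem proposition3p1:
  fixes \<alpha> \<sigma>0 \<beta> C1 C2 \<gamma> m \<delta> :: real
    and \<sigma> :: "real \<Rightarrow> ereal" and F :: "real \<Rightarrow> real"
    and M :: "'a measure" and X :: "nat \<Rightarrow> 'a \<Rightarrow> real"
    and N :: "'b measure" and Z :: "'b \<Rightarrow> real"
    and f f' :: "real \<Rightarrow> real"
  assumes "\<alpha> > 0" and "\<sigma>0 > 0" and "\<beta> > 0" and "C2 > 0" and "0 < \<gamma>" and "\<gamma> < \<alpha>"
    and F_0: "F 0 = 0"
    and F_eq: "\<And>x. x > 0 \<Longrightarrow> ereal (F x) = eexp (- (epowr (\<sigma> x) \<alpha> * ereal (x powr (- \<alpha>))))"
    and \<sigma>_pos: "\<And>x. x > 0 \<Longrightarrow> \<sigma> x > 0"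
    and \<sigma>_lim: "(\<sigma> \<longlongrightarrow> ereal \<sigma>0) at_top"
    and \<sigma>_lower: "\<And>x. x > 0 \<Longrightarrow> epowr (\<sigma> x) \<alpha> \<ge> ereal (C2 * min 1 (x powr \<gamma>))"
    and "C1 \<noteq> 0"
    and \<sigma>_asymp:
      "((\<lambda>x. (epowr (\<sigma> x) \<alpha> - ereal (\<sigma>0 powr \<alpha>)) / ereal (C1 * x powr (- \<beta>))) \<longlongrightarrow> 1) at_top"
    and "prob_space M"
    and X_indep: "prob_space.indep_vars M (\<lambda>_. borel) X {1..}"
    and X_cdf: "\<And>i. i \<ge> 1 \<Longrightarrow> cdf (distr M borel (X i)) = F"
    and "prob_space N"
    and Z_meas: "Z \<in> borel_measurable N"
    and Z_cdf: "\<And>x. x > 0 \<Longrightarrow> cdf (distr N borel Z) x = exp (- (\<sigma>0 powr \<alpha> * x powr (- \<alpha>)))"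
    and f_ac: "\<And>a b. 0 < a \<Longrightarrow> a \<le> b \<Longrightarrow> abs_continuous_on_Icc f a b"
    and f'_int: "\<And>a b. 0 < a \<Longrightarrow> a \<le> b \<Longrightarrow> set_integrable lebesgue {a..b} f'"
    and f_deriv: "AE x in lebesgue. 0 < x \<longrightarrow> (f has_real_derivative f' x) (at x)"
    and "\<delta> > 0"
    and f_at_0:
      "((\<lambda>x. ereal (x powr m * \<bar>f x\<bar>)
            + esssup (lebesgue_on {0<..x}) (\<lambda>y. ereal (y powr m * \<bar>f' y\<bar>))) \<longlongrightarrow> 0) (at_right 0)"
    and f_at_top:
      "((\<lambda>x. ereal (x powr (- \<alpha>) * \<bar>f x\<bar>)
            + ereal (x powr (1 + \<delta>)) *
              esssup (lebesgue_on {x..}) (\<lambda>y. ereal (y powr (- \<alpha>) * \<bar>f' y\<bar>))) \<longlongrightarrow> 0) at_top"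
    and f'_tail: "(\<integral>\<^sup>+x\<in>{1..}. ennreal (x powr (- (\<alpha> + \<beta>)) * \<bar>f' x\<bar>) \<partial>lebesgue) < \<infinity>"
  shows "(\<forall>n\<ge>1. pos_integrable M (scaled_max \<alpha> X n) f) \<and> pos_integrable N Z f
    \<and> set_integrable lebesgue {0<..}
        (\<lambda>x. x powr (- (\<alpha> + \<beta>)) * f' x * exp (- (\<sigma>0 powr \<alpha> * x powr (- \<alpha>))))
    \<and> (\<lambda>n. real n powr (\<beta> / \<alpha>)
            * (pos_expectation M (scaled_max \<alpha> X n) f - pos_expectation N Z f))
      \<longlonglongrightarrow> C1 * (LINT x:{0<..}|lebesgue.
              x powr (- (\<alpha> + \<beta>)) * f' x * exp (- (\<sigma>0 powr \<alpha> * x powr (- \<alpha>))))"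
proof -
  interpret M: prob_space M by fact
  interpret N: prob_space N by fact
  define s0 where "s0 = \<sigma>0 powr \<alpha>"
  define s where "s x = real_of_ereal (epowr (\<sigma> x) \<alpha>)" for x
  define G where "G x = exp (- (s0 * x powr (- \<alpha>)))" for x
  define H where "H n x = F (real n powr (1 / \<alpha>) * x) ^ n" for n x
  define L where "L x = C1 * (x powr (- (\<alpha> + \<beta>)) * exp (- (s0 * x powr (- \<alpha>))))" for x
  have "s0 > 0" using \<open>\<sigma>0 > 0\<close> by (simp add: s0_def)
  have X[measurable]: "X i \<in> borel_measurable M" if "i \<ge> 1" for i
    using X_indep that by (simp add: M.indep_vars_def2)
  have F_cdf: "F = cdf (distr M borel (X 1))" using X_cdf[of 1] by simp
  interpret D: real_distribution "distr M borel (X 1)"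
    using X[of 1] by (intro M.real_distribution_distr) simp
  have F_nonneg: "0 \<le> F x" for x
    unfolding F_cdf by (rule D.cdf_nonneg)
  have F_meas[measurable]: "F \<in> borel_measurable borel"
    unfolding F_cdf by (intro borel_measurable_mono monoI D.cdf_nondecreasing)
  have [measurable]: "G \<in> borel_measurable borel" "L \<in> borel_measurable borel"
    "H n \<in> borel_measurable borel" for n
    unfolding G_def H_def L_def by measurable
  have F_le: "F x \<le> exp (- (C2 * min 1 (x powr \<gamma>) * x powr (- \<alpha>)))" if "x > 0" for x
    using eexp_le_exp[OF F_eq[OF that] \<sigma>_lower[OF that]] that by simp
  have F_exp: "\<forall>\<^sub>F x in at_top. F x = exp (- (s x * x powr (- \<alpha>)))"
    and s_asymp: "((\<lambda>x. (s x - s0) / (C1 * x powr (- \<beta>))) \<longlongrightarrow> 1) at_top"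
    using eexp_real_asymptotics[OF F_eq \<sigma>_lower _ \<sigma>_asymp] \<open>C1 \<noteq> 0\<close>
    by (simp_all add: s_def s0_def)

  obtain g where g[measurable]: "g \<in> borel_measurable borel"
    and g_eq: "AE x in lborel. 0 < x \<longrightarrow> f' x = g x"
    and g_int: "\<And>a b. 0 < a \<Longrightarrow> a \<le> b \<Longrightarrow> set_integrable lborel {a..b} g"
    and f_diff: "\<And>a b. 0 < a \<Longrightarrow> a \<le> b \<Longrightarrow> (LINT x:{a..b}|lborel. g x) = f b - f a"
    using borel_density_of_abs_continuous[OF f_ac f'_int f_deriv] by blast
  obtain a where a: "a > 0" "AE y in lebesgue. 0 < y \<and> y \<le> a \<longrightarrow> y powr m * \<bar>f' y\<bar> \<le> 1"
    using deriv_bound_at_0[OF f_at_0] .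
  have g_at_0: "AE y in lborel. 0 < y \<and> y \<le> a \<longrightarrow> y powr m * \<bar>g y\<bar> \<le> 1"
    using a(2)[unfolded AE_completion_iff] g_eq by eventually_elim auto
  obtain b where b: "b \<ge> 1" "AE y in lebesgue. y \<ge> b \<longrightarrow>
      y powr (- \<alpha>) * \<bar>f' y\<bar> \<le> 2 powr (1 + \<delta>) * y powr (- (1 + \<delta>))"
    using deriv_bound_at_top[OF \<open>\<delta> > 0\<close> f_at_top] .
  have g_at_top: "AE y in lborel. y \<ge> b \<longrightarrow>
      y powr (- \<alpha>) * \<bar>g y\<bar> \<le> 2 powr (1 + \<delta>) * y powr (- (1 + \<delta>))"
    using b(2)[unfolded AE_completion_iff] g_eq by eventually_elim (use b(1) in auto)
  \<comment> \<open>Completion does not change nonnegative integrals, so the tail hypothesis passes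
    to the Borel version of \<open>f'\<close>.\<close>
  have g_tail: "set_integrable lborel {1..} (\<lambda>x. x powr (- (\<alpha> + \<beta>)) * g x)"
    unfolding set_integrable_def
  proof (rule integrableI_bounded)
    have "(\<integral>\<^sup>+x. ennreal (norm (indicator {1..} x *\<^sub>R (x powr (- (\<alpha> + \<beta>)) * g x))) \<partial>lborel)
        = (\<integral>\<^sup>+x\<in>{1..}. ennreal (x powr (- (\<alpha> + \<beta>)) * \<bar>f' x\<bar>) \<partial>lborel)"
      using g_eq by (intro nn_integral_cong_AE, eventually_elim)
        (auto simp: indicator_def abs_mult)
    then show "(\<integral>\<^sup>+x. ennreal (norm (indicator {1..} x *\<^sub>R (x powr (- (\<alpha> + \<beta>)) * g x))) \<partial>lborel) < \<infinity>"
      using f'_tail by (simp only: nn_integral_completion)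
  qed measurable

  obtain K c where c: "c > 0"
    and K: "\<And>n x. n \<ge> 1 \<Longrightarrow> x > 0 \<Longrightarrow> real n powr (\<beta> / \<alpha>) * \<bar>G x - H n x\<bar>
      \<le> K * tail_weight (\<alpha> + \<beta>) (\<alpha> - \<gamma>) c x"
    unfolding G_def H_def
    using cdf_power_bound[OF \<open>\<alpha> > 0\<close> \<open>s0 > 0\<close> \<open>\<beta> > 0\<close> \<open>C2 > 0\<close> \<open>0 < \<gamma>\<close> \<open>\<gamma> < \<alpha>\<close> \<open>C1 \<noteq> 0\<close>
        F_nonneg F_le F_exp s_asymp] by metis
  have gw: "set_integrable lborel {0<..} (\<lambda>x. g x * tail_weight (\<alpha> + \<beta>) (\<alpha> - \<gamma>) c x)"
    using \<open>\<gamma> < \<alpha>\<close> by (intro tail_weight_integrable[OF g _ c a(1) g_at_0 g_int g_tail]) auto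
  have lim: "(\<lambda>n. real n powr (\<beta> / \<alpha>) * (G x - H n x)) \<longlonglongrightarrow> L x" if "x \<in> {0<..}" for x
    unfolding G_def H_def L_def
    using that by (intro cdf_power_asymptotics[OF \<open>\<alpha> > 0\<close> \<open>\<beta> > 0\<close> \<open>C1 \<noteq> 0\<close> _ F_exp s_asymp]) simp
  have rate_pos: "real n powr (\<beta> / \<alpha>) > 0" if "n \<ge> 1" for n using that by simp
  have K': "real n powr (\<beta> / \<alpha>) * \<bar>G x - H n x\<bar> \<le> K * tail_weight (\<alpha> + \<beta>) (\<alpha> - \<gamma>) c x"
    if "n \<ge> 1" "x \<in> {0<..}" for n x
    using K[of n x] that by simp
  have diff_int: "set_integrable lborel {0<..} (\<lambda>x. g x * (G x - H n x))" if "n \<ge> 1" for n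
    by (rule scaled_set_integral_tendsto(1)[OF _ _ _ _ _ gw rate_pos K' lim that]) auto
  have L_int: "set_integrable lborel {0<..} (\<lambda>x. g x * L x)"
    by (rule scaled_set_integral_tendsto(2)[OF _ _ _ _ _ gw rate_pos K' lim]) auto
  have diff_lim: "(\<lambda>n. real n powr (\<beta> / \<alpha>) * (LINT x:{0<..}|lborel. g x * (G x - H n x)))
      \<longlonglongrightarrow> (LINT x:{0<..}|lborel. g x * L x)"
    by (rule scaled_set_integral_tendsto(3)[OF _ _ _ _ _ gw rate_pos K' lim]) auto

  have int_G: "set_integrable lborel {0<..} (\<lambda>x. g x * (indicator {1..} x - G x))"
    unfolding G_def
    by (rule frechet_tail_integrable[OF g \<open>\<alpha> > 0\<close> \<open>s0 > 0\<close> \<open>\<delta> > 0\<close> a(1) g_at_0 g_int b(1) g_at_top])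

  have cdf_Z: "cdf (distr N borel Z) x = G x" if "x > 0" for x
    using Z_cdf[OF that] by (simp add: G_def s0_def)
  have Z_pos: "AE \<omega> in N. 0 < Z \<omega>"
  proof (rule AE_pos_cdf[OF \<open>prob_space N\<close> Z_meas])
    interpret E: real_distribution "distr N borel Z"
      using Z_meas by (intro N.real_distribution_distr)
    \<comment> \<open>The law of \<open>Z\<close> is prescribed on positive arguments; monotonicity
      and this limit give the value 0 at 0.\<close>
    have "(G \<longlongrightarrow> 0) (at_right 0)"
      unfolding G_def using \<open>\<alpha> > 0\<close> \<open>s0 > 0\<close> by real_asymp
    moreover have "\<forall>\<^sub>F x in at_right 0. cdf (distr N borel Z) 0 \<le> G x"
      using eventually_at_right_less[of 0]
      by eventually_elim (metis cdf_Z E.cdf_nondecreasing less_imp_le)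
    ultimately have "cdf (distr N borel Z) 0 \<le> 0"
      by (intro tendsto_lowerbound) auto
    then show "cdf (distr N borel Z) 0 = 0"
      using E.cdf_nonneg[of 0] by linarith
  qed
  have Z_parts: "pos_integrable N Z f"
    "pos_expectation N Z f = f 1 + (LINT x:{0<..}|lborel. g x * (indicator {1..} x - G x))"
  proof -
    have cong: "indicator {0<..} x *\<^sub>R (g x * (indicator {1..} x - cdf (distr N borel Z) x))
      = indicator {0<..} x *\<^sub>R (g x * (indicator {1..} x - G x))" for x
      using cdf_Z by (auto simp: indicator_def)
    have int: "set_integrable lborel {0<..} (\<lambda>x. g x * (indicator {1..} x - cdf (distr N borel Z) x))"
      using int_G unfolding set_integrable_def cong .
    show "pos_integrable N Z f"
      by (rule pos_expectation_by_parts(1)[OF \<open>prob_space N\<close> Z_meas Z_pos g g_int f_diff int])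
    have "pos_expectation N Z f
        = f 1 + (LINT x:{0<..}|lborel. g x * (indicator {1..} x - cdf (distr N borel Z) x))"
      by (rule pos_expectation_by_parts(2)[OF \<open>prob_space N\<close> Z_meas Z_pos g g_int f_diff int])
    then show "pos_expectation N Z f = f 1 + (LINT x:{0<..}|lborel. g x * (indicator {1..} x - G x))"
      unfolding set_lebesgue_integral_def cong .
  qed

  have cdf_max: "cdf (distr M borel (scaled_max \<alpha> X n)) = H n" if "n \<ge> 1" for n
    using cdf_scaled_max[OF \<open>prob_space M\<close> X_indep X_cdf that, of \<alpha>] by (auto simp: H_def fun_eq_iff)
  \<comment> \<open>The integrand is the one for \<open>Z\<close> plus the difference just shown
    integrable, so the maxima need no separate tail estimate.\<close>
  have int_H: "set_integrable lborel {0<..} (\<lambda>x. g x * (indicator {1..} x - H n x))" if "n \<ge> 1" for n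
    using set_integral_add(1)[OF int_G diff_int[OF that]] by (simp add: algebra_simps)
  have max_parts: "pos_integrable M (scaled_max \<alpha> X n) f"
    "pos_expectation M (scaled_max \<alpha> X n) f
      = f 1 + (LINT x:{0<..}|lborel. g x * (indicator {1..} x - H n x))" if n: "n \<ge> 1" for n
  proof -
    have meas: "scaled_max \<alpha> X n \<in> borel_measurable M"
      by (rule borel_measurable_scaled_max[OF X])
    \<comment> \<open>\<open>F 0 = 0\<close> makes the maximum almost surely positive;
      \<open>n \<ge> 1\<close> matters, since a zeroth power would be 1.\<close>
    have "H n 0 = 0" using n F_0 by (simp add: H_def)
    then have pos: "AE \<omega> in M. 0 < scaled_max \<alpha> X n \<omega>"
      using cdf_max[OF n] by (intro AE_pos_cdf[OF \<open>prob_space M\<close> meas]) simp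
    have int: "set_integrable lborel {0<..}
        (\<lambda>x. g x * (indicator {1..} x - cdf (distr M borel (scaled_max \<alpha> X n)) x))"
      using int_H[OF n] unfolding cdf_max[OF n] .
    show "pos_integrable M (scaled_max \<alpha> X n) f"
      by (rule pos_expectation_by_parts(1)[OF \<open>prob_space M\<close> meas pos g g_int f_diff int])
    show "pos_expectation M (scaled_max \<alpha> X n) f
      = f 1 + (LINT x:{0<..}|lborel. g x * (indicator {1..} x - H n x))"
      unfolding cdf_max[OF n, symmetric]
      by (rule pos_expectation_by_parts(2)[OF \<open>prob_space M\<close> meas pos g g_int f_diff int])
  qed
  \<comment> \<open>The base value f(1) and the indicators cancel, leaving the integral of g (G - H
    n).\<close>
  have diff: "pos_expectation M (scaled_max \<alpha> X n) f - pos_expectation N Z f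
      = (LINT x:{0<..}|lborel. g x * (G x - H n x))" if "n \<ge> 1" for n
    using set_integral_diff(2)[OF int_H[OF that] int_G]
    by (simp add: max_parts(2)[OF that] Z_parts(2) algebra_simps)
  have lim_diff: "(\<lambda>n. real n powr (\<beta> / \<alpha>)
        * (pos_expectation M (scaled_max \<alpha> X n) f - pos_expectation N Z f))
      \<longlonglongrightarrow> (LINT x:{0<..}|lborel. g x * L x)"
    by (rule Lim_transform_eventually[OF diff_lim])
      (use eventually_ge_at_top[of 1] in \<open>eventually_elim; simp add: diff\<close>)

  \<comment> \<open>It remains to return to \<open>f'\<close> and the completed measure;
    \<open>L\<close> carries the factor \<open>C1\<close>, which is divided out.\<close>
  let ?u = "\<lambda>x. x powr (- (\<alpha> + \<beta>)) * f' x * exp (- (s0 * x powr (- \<alpha>)))"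
  let ?v = "\<lambda>x. inverse C1 * (g x * L x)"
  have u_meas: "(\<lambda>x. indicator {0<..} x * ?u x) \<in> borel_measurable lebesgue"
  proof -
    have w: "(\<lambda>x. x powr (- (\<alpha> + \<beta>)) * exp (- (s0 * x powr (- \<alpha>)))) \<in> borel_measurable lebesgue"
      by (rule measurable_completion) measurable
    have "indicator {0<..} x * ?u x
        = (indicator {0<..} x * f' x) * (x powr (- (\<alpha> + \<beta>)) * exp (- (s0 * x powr (- \<alpha>))))" for x
      by (simp only: mult_ac)
    then show ?thesis
      using borel_measurable_times[OF borel_measurable_lebesgue_Ioi[OF f'_int] w] by (simp only:)
  qed
  have u_eq: "AE x in lborel. x \<in> {0<..} \<longrightarrow> ?u x = ?v x"
    using g_eq by eventually_elim (use \<open>C1 \<noteq> 0\<close> in \<open>auto simp: L_def\<close>)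
  have "?v \<in> borel_measurable borel" by measurable
  note transfer = set_integral_lebesgue_lborel[OF _ this u_meas u_eq]
  have "set_integrable lebesgue {0<..} ?u"
    using L_int transfer(1) by simp
  moreover have "(LINT x:{0<..}|lborel. g x * L x) = C1 * (LINT x:{0<..}|lebesgue. ?u x)"
    using transfer(2) \<open>C1 \<noteq> 0\<close> by simp
  ultimately show ?thesis
    using max_parts(1) Z_parts(1) lim_diff by (simp add: s0_def)
qed

end
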